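(* Let $k\geqslant 2$ be an integer and put $B=k+1$. For every $\varepsilon>0$ and every $A\geqslant B$ there is a constant $C=C(A,\varepsilon,k)>0$ such that for all positive integers $N$ and all integers $H$ with $N^B\leqslant H\leqslant N^A$, $$\left|\dfrac{1}{\#\mathcal{F}_k(H)}\sum_{f\in\mathcal{F}_k(H)} \left(S_f^{\square}(N)-c_{f}N\right)\right|\leqslant C\, N^{\varepsilon}.$$
   Context: For $f(X)\in\mathbb Z[X]$ and a positive integer $N$, $S_f^{\square}(N)$ denotes the number of positive integers $n\leqslant N$ such that $f(n)$ is square-free. For an integer $m\geqslant 1$, $\rho_f(m):=\#\{n\in\mathbb Z/m\mathbb Z: f(n)\equiv 0\pmod{m}\}$, and $$c_f:=\sum_{d\geqslant 1}\dfrac{\mu(d)}{d^2}\rho_f(d^2),$$ where $\mu$ is the Möbius function. For positive integers $H$ and $k\geqslant 2$, let $\mathcal{B}_k(H):=\{\mathbf{a}=(a_0,\dots,a_k)\in\mathbb Z^{k+1}: \gcd(a_0,a_1,\dots,a_k)=1,\ |a_i|\leqslant H \text{ for all } i\}$ and $\mathcal{F}_k(H):=\{a_0+a_1X+\cdots+a_kX^k\in\mathbb Z[X]: \mathbf{a}\in\mathcal{B}_k(H)\}$. *)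

theory Defs
  imports
    "HOL-Analysis.Analysis"
    "HOL-Computational_Algebra.Computational_Algebra"
    "HOL-Number_Theory.Cong"
begin

definition moebius_mu :: "nat \<Rightarrow> int" where
  "moebius_mu n = (if squarefree n then (-1) ^ card (prime_factors n) else 0)"

definition squarefree_count :: "int poly \<Rightarrow> nat \<Rightarrow> nat" where
  "squarefree_count f N = card {n :: nat. 1 \<le> n \<and> n \<le> N \<and> squarefree (poly f (int n))}"

definition root_count :: "int poly \<Rightarrow> nat \<Rightarrow> nat" where
  "root_count f m = card {n :: int. 0 \<le> n \<and> n < int m \<and> [poly f n = 0] (mod (int m))}"

text \<open>
  The series is summed in increasing order of \<open>d\<close>: it need not converge absolutely
  when \<open>f\<close> has a multiple root (for \<open>f = X\<^sup>2\<close> it is \<open>\<Sum>\<mu>(d)/d\<close>), so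
  \<^const>\<open>suminf\<close> is used rather than \<^const>\<open>infsum\<close>. The index is
  shifted so that the summation starts at \<open>d = 1\<close>.
\<close>
definition sqfree_density :: "int poly \<Rightarrow> real" where
  "sqfree_density f =
     (\<Sum>j. let d = Suc j in
        real_of_int (moebius_mu d) / (real d)\<^sup>2 * real (root_count f (d\<^sup>2)))"

definition primitive_tuples :: "nat \<Rightarrow> int \<Rightarrow> (nat \<Rightarrow> int) set" where
  "primitive_tuples k H =
     {a. a \<in> extensional {0..k} \<and> Gcd (a ` {0..k}) = 1 \<and> (\<forall>i\<in>{0..k}. \<bar>a i\<bar> \<le> H)}"

definition primitive_polys :: "nat \<Rightarrow> int \<Rightarrow> int poly set" where
  "primitive_polys k H = (\<lambda>a. \<Sum>i=0..k. monom (a i) i) ` primitive_tuples k H"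

end

theory Submission
  imports Defs
begin

text \<open>
  Both \<open>S\<^sub>f(N)\<close> and \<open>c\<^sub>f\<close> are Moebius sums over \<open>d\<close>, which are cut at \<open>d = N\<close>.

  For \<open>d \<le> N\<close>, fix all coefficients of \<open>f\<close> but the constant one: the number of admissible
  constant terms with \<open>d\<^sup>2\<close> dividing \<open>f(n)\<close> depends on \<open>n\<close> only up to a small power of \<open>H\<close>, so on
  average over \<open>f\<close> the count for \<open>n \<le> N\<close> agrees with \<open>N\<close> times the density of the roots modulo \<open>d\<^sup>2\<close>.

  For \<open>d > N\<close> in \<open>S\<^sub>f(N)\<close>, every value is taken at \<open>n\<close> by \<open>O((H/n)\<^sup>k)\<close> polynomials of the box,
  and there are \<open>O(H n\<^sup>k / d\<^sup>2)\<close> nonzero multiples of \<open>d\<^sup>2\<close> among the possible values, so a proportion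
  \<open>O(1/d\<^sup>2)\<close> of the polynomials is concerned.

  For \<open>d > N\<close> in \<open>c\<^sub>f\<close>, if \<open>f\<close> and its derivative have no common root, some nonzero integer
  \<open>\<Delta>\<close> of polynomial size in \<open>H\<close> lies in the ideal generated by \<open>f\<close> and \<open>f'\<close>, and Hensel's
  lemma gives \<open>\<rho>\<^sub>f(d\<^sup>2) \<le> k\<^sup>\<omega>\<^sup>(\<^sup>d\<^sup>) gcd(d, \<Delta>)\<close>; hence the tail is \<open>O(N\<^sup>\<epsilon>\<^sup>-\<^sup>1)\<close>. The remaining
  polynomials form a proportion \<open>O(1/H)\<close>, because a root of the derivative determines the constant
  term, and for them \<open>c\<^sub>f\<close> is bounded by Abel's theorem and an Euler product.
\<close>

section \<open>Moebius sums and prime factors\<close>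

lemma moebius_mu_abs_le: "\<bar>real_of_int (moebius_mu d)\<bar> \<le> 1"
  by (simp add: moebius_mu_def)

lemma prime_factors_prod_primes:
  fixes T :: "nat set"
  assumes "finite T" "\<And>p. p \<in> T \<Longrightarrow> prime p"
  shows "prime_factors (\<Prod>T) = T"
proof -
  have "prime_factors (\<Prod>T) = \<Union>((prime_factors \<circ> (\<lambda>x. x)) ` T)"
    using assms by (subst prime_factors_prod) (auto simp: image_iff dest: assms(2)[of 0])
  also have "\<dots> = T"
    using assms by (auto simp: prime_prime_factors)
  finally show ?thesis .
qed

lemma squarefree_prod_primes:
  fixes T :: "nat set"
  assumes "\<And>p. p \<in> T \<Longrightarrow> prime p"
  shows "squarefree (\<Prod>T)"
  using assms by (intro squarefree_prod_coprime) (auto simp: squarefree_prime primes_coprime)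

lemma prod_prime_factors_squarefree:
  fixes d :: nat
  assumes "squarefree d"
  shows "\<Prod>(prime_factors d) = d"
proof -
  have d0: "d \<noteq> 0" using assms by (metis not_squarefree_0)
  have "(\<Prod>p\<in>prime_factors d. p ^ multiplicity p d) = d"
    using prod_prime_factors[OF d0] by simp
  moreover have "(\<Prod>p\<in>prime_factors d. p ^ multiplicity p d) = (\<Prod>p\<in>prime_factors d. p)"
    using assms d0 by (intro prod.cong) (auto simp: squarefree_factorial_semiring')
  ultimately show ?thesis by simp
qed

text \<open>A squarefree number is determined by its set of prime divisors, so sums over squarefree
  numbers supported on \<open>S\<close> become sums over the subsets of \<open>S\<close>.\<close>

lemma squarefree_prime_support:
  fixes S :: "nat set"
  assumes "finite S" "\<And>p. p \<in> S \<Longrightarrow> prime p"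
  shows "bij_betw Prod (Pow S) {d. squarefree d \<and> prime_factors d \<subseteq> S}"
proof (rule bij_betwI[where g = prime_factors])
  show "Prod \<in> Pow S \<rightarrow> {d. squarefree d \<and> prime_factors d \<subseteq> S}"
  proof
    fix T assume T: "T \<in> Pow S"
    hence "finite T" using assms finite_subset by auto
    thus "\<Prod>T \<in> {d. squarefree d \<and> prime_factors d \<subseteq> S}"
      using T assms prime_factors_prod_primes[of T] squarefree_prod_primes[of T] by auto
  qed
next
  fix T assume T: "T \<in> Pow S"
  hence "finite T" using assms finite_subset by auto
  thus "prime_factors (\<Prod>T) = T"
    using T assms by (intro prime_factors_prod_primes) auto
qed (auto simp: prod_prime_factors_squarefree)

text \<open>Expanding the product over the subsets of \<open>S\<close> produces one signed term for
  each squarefree number. Multiplicativity of \<open>h\<close> is asked only on products of distinct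
  primes, the form in which it is available for root counts. The ring is general because both
  integer and real sums are expanded this way.\<close>

lemma sum_moebius_euler_product:
  fixes S :: "nat set" and h g :: "nat \<Rightarrow> 'a :: comm_ring_1"
  assumes S: "finite S" "\<And>p. p \<in> S \<Longrightarrow> prime p"
    and h: "\<And>T. T \<subseteq> S \<Longrightarrow> h (\<Prod>T) = (\<Prod>p\<in>T. g p)"
  shows "(\<Sum>d | squarefree d \<and> prime_factors d \<subseteq> S. of_int (moebius_mu d) * h d)
         = (\<Prod>p\<in>S. 1 - g p)"
proof -
  have "(\<Sum>d | squarefree d \<and> prime_factors d \<subseteq> S. of_int (moebius_mu d) * h d)
        = (\<Sum>T\<in>Pow S. of_int (moebius_mu (\<Prod>T)) * h (\<Prod>T))"
    by (rule sum.reindex_bij_betw[OF squarefree_prime_support[OF S], symmetric])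
  also have "\<dots> = (\<Sum>T\<in>Pow S. (-1) ^ card T * (\<Prod>p\<in>T. g p))"
  proof (rule sum.cong)
    fix T assume T: "T \<in> Pow S"
    hence "finite T" using S finite_subset by auto
    hence "moebius_mu (\<Prod>T) = (-1) ^ card T"
      using T S by (subst moebius_mu_def, subst prime_factors_prod_primes)
        (auto simp: subset_iff intro!: squarefree_prod_primes)
    thus "of_int (moebius_mu (\<Prod>T)) * h (\<Prod>T) = (-1) ^ card T * (\<Prod>p\<in>T. g p)"
      using h[of T] T by simp
  qed simp
  also have "\<dots> = (\<Prod>p\<in>S. 1 - g p)"
    using S by (subst prod_diff_conv_sum) auto
  finally show ?thesis .
qed

text \<open>The sum is the Euler product over the primes of \<open>g\<close> in which every factor
  is 1 - 1; that product is empty exactly when \<open>g = 1\<close>.\<close>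

lemma sum_moebius_dvd:
  fixes g :: nat
  assumes "g > 0"
  shows "(\<Sum>e | e dvd g. moebius_mu e) = (if g = 1 then 1 else 0)"
proof -
  have "(\<Sum>e | e dvd g. moebius_mu e)
      = (\<Sum>e | squarefree e \<and> prime_factors e \<subseteq> prime_factors g. of_int (moebius_mu e) * 1)"
  proof (rule sum.mono_neutral_cong_right)
    show "{e. squarefree e \<and> prime_factors e \<subseteq> prime_factors g} \<subseteq> {e. e dvd g}"
    proof safe
      fix e :: nat assume e: "squarefree e" "prime_factors e \<subseteq> prime_factors g"
      show "e dvd g"
      proof (rule multiplicity_le_imp_dvd)
        fix p :: nat assume p: "prime p"
        show "multiplicity p e \<le> multiplicity p g"
        proof (cases "p dvd e")
          case True
          have "e \<noteq> 0" using e(1) by (metis not_squarefree_0)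
          with e p True have "multiplicity p e = 1" "p \<in> prime_factors g"
            by (auto simp: squarefree_factorial_semiring' prime_factors_dvd)
          thus ?thesis using p assms by (simp add: prime_factors_multiplicity)
        qed (simp add: not_dvd_imp_multiplicity_0)
      qed (use e in \<open>auto intro!: Nat.gr0I\<close>)
    qed
  qed (use assms in \<open>auto simp: moebius_mu_def prime_factors_dvd intro: dvd_trans\<close>)
  also have "\<dots> = (\<Prod>p\<in>prime_factors g. 1 - 1)"
    by (rule sum_moebius_euler_product) auto
  also have "\<dots> = (if g = 1 then 1 else 0)"
    using assms by (auto simp: card_gt_0_iff prime_factorization_empty_iff)
  finally show ?thesis .
qed

text \<open>The numbers whose square divides \<open>m\<close> are exactly the divisors of the square
  part of \<open>m\<close>, which reduces the claim to the classical divisor sum.\<close>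

lemma sum_moebius_square_dvd:
  fixes m :: int
  assumes "m \<noteq> 0"
  shows "(\<Sum>d | (int d)\<^sup>2 dvd m. moebius_mu d) = (if squarefree m then 1 else 0)"
proof -
  define s where "s = square_part (nat \<bar>m\<bar>)"
  have s0: "s > 0" using assms by (auto simp: s_def intro!: Nat.gr0I)
  have iff: "(int d)\<^sup>2 dvd m \<longleftrightarrow> d dvd s" for d
  proof -
    have "(int d)\<^sup>2 dvd m \<longleftrightarrow> int (d\<^sup>2) dvd int (nat \<bar>m\<bar>)" by simp
    also have "\<dots> \<longleftrightarrow> d\<^sup>2 dvd nat \<bar>m\<bar>" by (rule int_dvd_int_iff)
    also have "\<dots> \<longleftrightarrow> d dvd s" unfolding s_def by (simp add: dvd_square_part_iff)
    finally show ?thesis .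
  qed
  have "squarefree m \<longleftrightarrow> s = 1"
  proof
    assume sq: "squarefree m"
    have "(int s)\<^sup>2 dvd m" using iff by simp
    with sq have "int s dvd 1" by (rule squarefreeD)
    thus "s = 1" by simp
  next
    assume s1: "s = 1"
    show "squarefree m"
    proof (rule squarefreeI)
      fix x :: int assume "x\<^sup>2 dvd m"
      hence "(int (nat \<bar>x\<bar>))\<^sup>2 dvd m" by simp
      hence "nat \<bar>x\<bar> dvd 1" using iff s1 by blast
      thus "x dvd 1" by simp
    qed
  qed
  thus ?thesis using sum_moebius_dvd[OF s0] iff by simp
qed

section \<open>Divisor-type bounds in terms of the number of prime factors\<close>

text \<open>Each large prime factor \<open>p\<close> pays for its own factor \<open>K\<close> by
  \<open>p powr \<epsilon>\<close>, and the boundedly many small primes are absorbed by the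
  constant.\<close>

lemma power_card_prime_factors_bound:
  fixes K \<epsilon> :: real
  assumes "K \<ge> 1" "\<epsilon> > 0"
  shows "\<exists>C\<ge>1. \<forall>m::nat. m > 0 \<longrightarrow> K ^ card (prime_factors m) \<le> C * real m powr \<epsilon>"
proof -
  \<comment> \<open>This is the threshold from which on \<open>p powr \<epsilon>\<close> is at least
    \<open>K\<close>; the constant becomes \<open>K ^ P\<close>.\<close>
  define P where "P = nat \<lceil>K powr (1 / \<epsilon>)\<rceil>"
  have big: "K \<le> real p powr \<epsilon>" if "p \<ge> P" for p
  proof -
    have "K powr (1 / \<epsilon>) \<le> real p" using that by (simp add: P_def)
    hence "(K powr (1 / \<epsilon>)) powr \<epsilon> \<le> real p powr \<epsilon>" using assms by (intro powr_mono2) auto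
    thus ?thesis using assms by (simp add: powr_powr)
  qed
  have "K ^ card (prime_factors m) \<le> K ^ P * real m powr \<epsilon>" if m: "m > 0" for m :: nat
  proof -
    let ?A = "{p \<in> prime_factors m. p < P}" and ?B = "{p \<in> prime_factors m. p \<ge> P}"
    have un: "prime_factors m = ?A \<union> ?B" by auto
    have "card ?A \<le> card {..<P}" by (rule card_mono) auto
    hence A: "K ^ card ?A \<le> K ^ P" using assms by (intro power_increasing) auto
    have "K ^ card ?B = (\<Prod>p\<in>?B. K)" by simp
    also have "\<dots> \<le> (\<Prod>p\<in>?B. real p powr \<epsilon>)" using assms big by (intro prod_mono) auto
    also have "\<dots> = real (\<Prod>?B) powr \<epsilon>" by (simp add: prod_powr_distrib)
    also have "\<dots> \<le> real m powr \<epsilon>"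
    proof (intro powr_mono2)
      have "(\<Prod>?B) dvd (\<Prod>(prime_factors m))" by (rule prod_dvd_prod_subset) auto
      also have "\<dots> dvd (\<Prod>p\<in>prime_factors m. p ^ multiplicity p m)"
        using m by (intro prod_dvd_prod dvd_power) (auto simp: prime_factors_multiplicity)
      also have "\<dots> = m" using prod_prime_factors[of m] m by simp
      finally show "real (\<Prod>?B) \<le> real m" using m by (auto dest: dvd_imp_le simp del: of_nat_prod)
    qed (use assms in \<open>auto intro!: prod_nonneg\<close>)
    finally have B: "K ^ card ?B \<le> real m powr \<epsilon>" .
    have "K ^ card (prime_factors m) = K ^ card ?A * K ^ card ?B"
      by (subst un, subst card_Un_disjoint) (auto simp: power_add)
    also have "\<dots> \<le> K ^ P * real m powr \<epsilon>" using A B assms by (intro mult_mono) auto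
    finally show ?thesis .
  qed
  moreover have "K ^ P \<ge> 1" using assms by simp
  ultimately show ?thesis by blast
qed

lemma card_squarefree_divisors:
  fixes m :: nat
  assumes "m > 0"
  shows "card {g. squarefree g \<and> g dvd m} \<le> 2 ^ card (prime_factors m)"
proof -
  have bij: "bij_betw Prod (Pow (prime_factors m)) {d. squarefree d \<and> prime_factors d \<subseteq> prime_factors m}"
    by (rule squarefree_prime_support) auto
  have fin: "finite {d. squarefree d \<and> prime_factors d \<subseteq> prime_factors m}"
    using bij_betw_finite[OF bij] by simp
  have "card {g. squarefree g \<and> g dvd m} \<le> card {d. squarefree d \<and> prime_factors d \<subseteq> prime_factors m}"
    using assms by (intro card_mono fin) (auto dest: dvd_prime_factors[rotated])
  also have "\<dots> = card (Pow (prime_factors m))" using bij_betw_same_card[OF bij] by simp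
  finally show ?thesis by (simp add: card_Pow)
qed

section \<open>Roots modulo squares\<close>

text \<open>The remainder \<open>t\<close> stays existential, since only the divisibility of
  \<open>h\<^sup>2 * t\<close> matters in the lifting argument. Induction on the polynomial keeps
  everything integral, without factorials in denominators.\<close>

lemma poly_taylor_second_order:
  fixes f :: "'a :: idom poly"
  shows "\<exists>t. poly f (x + h) = poly f x + h * poly (pderiv f) x + h\<^sup>2 * t"
proof (induction f)
  case (pCons a p)
  then obtain t where t: "poly p (x + h) = poly p x + h * poly (pderiv p) x + h\<^sup>2 * t" by blast
  have "poly (pCons a p) (x + h) = poly (pCons a p) x + h * poly (pderiv (pCons a p)) x
          + h\<^sup>2 * ((x + h) * t + poly (pderiv p) x)"
    unfolding poly_pCons t pderiv_pCons by (simp add: algebra_simps power2_eq_square)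
  thus ?case by blast
qed simp

lemma poly_cong_int:
  fixes f :: "int poly"
  assumes "[x = y] (mod m)"
  shows "[poly f x = poly f y] (mod m)"
  by (induction f) (auto intro!: cong_add cong_mult assms)

definition mod_roots :: "int poly \<Rightarrow> nat \<Rightarrow> int set" where
  "mod_roots f m = {n. 0 \<le> n \<and> n < int m \<and> [poly f n = 0] (mod int m)}"

lemma root_count_eq: "root_count f m = card (mod_roots f m)"
  by (simp add: root_count_def mod_roots_def)

lemma mod_roots_subset: "mod_roots f m \<subseteq> {0..<int m}"
  by (auto simp: mod_roots_def)

lemma finite_mod_roots [simp, intro]: "finite (mod_roots f m)"
  using mod_roots_subset by (rule finite_subset) simp

lemma root_count_le: "root_count f m \<le> m"
  unfolding root_count_eq using card_mono[OF _ mod_roots_subset[of f m]] by simp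

lemma mod_roots_modI:
  assumes "m > 0" "[poly f n = 0] (mod int m)"
  shows "n mod int m \<in> mod_roots f m"
proof -
  have "[poly f (n mod int m) = poly f n] (mod int m)" by (intro poly_cong_int) simp
  with assms show ?thesis by (auto simp: mod_roots_def dest: cong_trans)
qed

text \<open>Chinese remainder theorem: reduction modulo \<open>a\<close> and modulo \<open>b\<close>
  is a bijection between the roots modulo \<open>a * b\<close> and the pairs of roots.\<close>

lemma root_count_mult:
  assumes "coprime a b" "a > 0" "b > 0"
  shows "root_count f (a * b) = root_count f a * root_count f b"
proof -
  have cop: "coprime (int a) (int b)" using assms by simp
  have "bij_betw (\<lambda>n. (n mod int a, n mod int b)) (mod_roots f (a * b)) (mod_roots f a \<times> mod_roots f b)"
  proof (rule bij_betw_imageI)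
    show "inj_on (\<lambda>n. (n mod int a, n mod int b)) (mod_roots f (a * b))"
    proof (rule inj_onI)
      fix x y assume xy: "x \<in> mod_roots f (a * b)" "y \<in> mod_roots f (a * b)"
        "(x mod int a, x mod int b) = (y mod int a, y mod int b)"
      hence "[x = y] (mod int a)" "[x = y] (mod int b)" by (auto simp: cong_def)
      hence "[x = y] (mod int a * int b)" using cop by (simp add: coprime_cong_mult)
      thus "x = y" using xy by (auto simp: mod_roots_def cong_def)
    qed
    show "(\<lambda>n. (n mod int a, n mod int b)) ` mod_roots f (a * b) = mod_roots f a \<times> mod_roots f b"
    proof (intro equalityI subsetI)
      fix z assume "z \<in> (\<lambda>n. (n mod int a, n mod int b)) ` mod_roots f (a * b)"
      then obtain n where n: "n \<in> mod_roots f (a * b)" "z = (n mod int a, n mod int b)" by auto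
      have "[poly f n = 0] (mod int a * int b)" using n by (simp add: mod_roots_def)
      hence "[poly f n = 0] (mod int a)" "[poly f n = 0] (mod int b)"
        by (auto intro: cong_modulus_mult simp: mult.commute)
      thus "z \<in> mod_roots f a \<times> mod_roots f b" using n assms by (auto intro!: mod_roots_modI)
    next
      fix z assume "z \<in> mod_roots f a \<times> mod_roots f b"
      then obtain r s where rs: "z = (r, s)" "r \<in> mod_roots f a" "s \<in> mod_roots f b" by auto
      obtain x where x: "[x = r] (mod int a)" "[x = s] (mod int b)"
        using binary_chinese_remainder_int[OF cop] by blast
      have "[poly f x = 0] (mod int a)"
        using poly_cong_int[OF x(1), of f] rs by (auto simp: mod_roots_def dest: cong_trans)
      moreover have "[poly f x = 0] (mod int b)"
        using poly_cong_int[OF x(2), of f] rs by (auto simp: mod_roots_def dest: cong_trans)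
      ultimately have "[poly f x = 0] (mod int (a * b))" using cop by (simp add: coprime_cong_mult)
      hence "x mod int (a * b) \<in> mod_roots f (a * b)" using assms by (intro mod_roots_modI) auto
      moreover have "x mod int (a * b) mod int a = r" "x mod int (a * b) mod int b = s"
        using x rs by (auto simp: mod_roots_def cong_def mod_mod_cancel)
      ultimately show "z \<in> (\<lambda>n. (n mod int a, n mod int b)) ` mod_roots f (a * b)"
        using rs by (intro image_eqI[of _ _ "x mod int (a * b)"]) auto
    qed
  qed
  thus ?thesis by (simp add: root_count_eq bij_betw_same_card card_cartesian_product)
qed

lemma root_count_1: "root_count f (Suc 0) = 1"
proof -
  have "mod_roots f (Suc 0) = {0}" by (auto simp: mod_roots_def)
  thus ?thesis by (simp add: root_count_eq)
qed

lemma root_count_prod_primes_square: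
  fixes T :: "nat set"
  assumes "finite T" "\<And>p. p \<in> T \<Longrightarrow> prime p"
  shows "root_count f ((\<Prod>T)\<^sup>2) = (\<Prod>p\<in>T. root_count f (p\<^sup>2))"
  using assms
proof (induction T rule: finite_induct)
  case empty
  thus ?case by (simp add: root_count_1)
next
  case (insert p T)
  have "coprime p (\<Prod>T)"
    using insert by (intro prod_coprime_right) (auto intro!: primes_coprime)
  moreover have "\<Prod>T > 0" using insert.prems by (intro prod_pos) (auto simp: prime_gt_0_nat)
  moreover have "p > 0" using insert.prems by (auto simp: prime_gt_0_nat)
  ultimately have "root_count f (p\<^sup>2 * (\<Prod>T)\<^sup>2) = root_count f (p\<^sup>2) * root_count f ((\<Prod>T)\<^sup>2)"
    by (intro root_count_mult) auto
  thus ?case using insert by (simp add: power_mult_distrib)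
qed

section \<open>Root counts modulo primes and squares of squarefree numbers\<close>

text \<open>Lagrange's theorem over the field with \<open>p\<close> elements. Synthetic division by
  a root lowers the degree, and the quotient cannot vanish modulo \<open>p\<close> because
  \<open>f\<close> would then vanish too.\<close>

lemma root_count_prime_le_degree:
  fixes f :: "int poly" and p :: nat
  assumes "prime p" "degree f \<le> k" "\<not> (\<forall>i. int p dvd coeff f i)"
  shows "root_count f p \<le> k"
  using assms(2,3)
proof (induction k arbitrary: f)
  case 0
  then obtain c where c: "f = [:c:]" by (auto elim: degree_eq_zeroE)
  have "\<not> int p dvd c"
    using 0 c const_poly_dvd_iff[of "int p" "[:c:]"] by simp
  hence "mod_roots f p = {}" using c by (auto simp: mod_roots_def cong_0_iff)
  thus ?case by (simp add: root_count_eq)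
next
  case (Suc k)
  show ?case
  proof (cases "mod_roots f p = {}")
    case True
    thus ?thesis by (simp add: root_count_eq)
  next
    case False
    then obtain r where r: "r \<in> mod_roots f p" by auto
    define q where "q = synthetic_div f r"
    have fq: "f = [:- r, 1:] * q + [:poly f r:]"
      unfolding q_def by (rule synthetic_div_correct'[symmetric])
    have pr: "int p dvd poly f r" using r by (auto simp: mod_roots_def cong_0_iff)
    have "\<not> (\<forall>i. int p dvd coeff q i)"
    proof
      assume *: "\<forall>i. int p dvd coeff q i"
      have "int p dvd coeff f i" for i
        by (subst fq) (use * pr in \<open>auto simp: coeff_pCons split: nat.splits\<close>)
      thus False using Suc.prems by blast
    qed
    moreover have "degree q \<le> k" using Suc.prems by (simp add: q_def degree_synthetic_div)
    ultimately have IH: "root_count q p \<le> k" using Suc.IH by blast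
    have "mod_roots f p \<subseteq> insert r (mod_roots q p)"
    proof
      fix s assume s: "s \<in> mod_roots f p"
      have "poly f s = (s - r) * poly q s + poly f r"
        by (subst fq) (simp add: algebra_simps)
      moreover have "int p dvd poly f s" using s by (auto simp: mod_roots_def cong_0_iff)
      ultimately have "int p dvd (s - r) * poly q s" using pr by (metis dvd_add_left_iff)
      hence "int p dvd s - r \<or> int p dvd poly q s"
        using assms(1) by (simp add: prime_dvd_mult_iff)
      moreover have "s = r" if "int p dvd s - r"
        using that r s by (auto simp: mod_roots_def zdvd_not_zless mod_eq_dvd_iff[symmetric])
      ultimately show "s \<in> insert r (mod_roots q p)" using s
        by (auto simp: mod_roots_def cong_0_iff)
    qed
    hence "card (mod_roots f p) \<le> card (insert r (mod_roots q p))" by (intro card_mono) auto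
    also have "\<dots> \<le> Suc (card (mod_roots q p))" by (rule card_insert_le_m1) auto
    finally show ?thesis using IH by (simp add: root_count_eq)
  qed
qed

lemma content_1_not_dvd_coeffs:
  fixes f :: "int poly" and p :: nat
  assumes "content f = 1" "prime p"
  shows "\<not> (\<forall>i. int p dvd coeff f i)"
proof
  assume "\<forall>i. int p dvd coeff f i"
  hence "int p dvd content f" by (simp add: const_poly_dvd_iff_dvd_content[symmetric] const_poly_dvd_iff)
  thus False using assms by auto
qed

text \<open>The gcd encodes two cases. If \<open>p\<close> divides \<open>\<Delta>\<close>, each of
  the at most \<open>k\<close> roots modulo \<open>p\<close> has at most \<open>p\<close> lifts.
  Otherwise no root modulo \<open>p\<close> is a root of the derivative, and each root has at most
  one lift, which is the uniqueness half of Hensel's lemma.\<close>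

lemma root_count_prime_square_le:
  fixes f u v :: "int poly" and p :: nat
  assumes p: "prime p" and f: "content f = 1" "degree f \<le> k"
    and uv: "u * f + v * pderiv f = [:\<Delta>:]"
  shows "root_count f (p\<^sup>2) \<le> k * gcd p (nat \<bar>\<Delta>\<bar>)"
proof -
  have p0: "p > 0" using p by (rule prime_gt_0_nat)
  have k: "root_count f p \<le> k"
    using root_count_prime_le_degree[OF p f(2) content_1_not_dvd_coeffs[OF f(1) p]] .
  have red: "n mod int p \<in> mod_roots f p" if "n \<in> mod_roots f (p\<^sup>2)" for n
  proof (rule mod_roots_modI[OF p0])
    have "[poly f n = 0] (mod int p * int p)" using that by (simp add: mod_roots_def power2_eq_square)
    thus "[poly f n = 0] (mod int p)" by (rule cong_modulus_mult)
  qed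
  show ?thesis
  proof (cases "p dvd nat \<bar>\<Delta>\<bar>")
    case True
    have "mod_roots f (p\<^sup>2) \<subseteq> (\<lambda>(r, j). r + int p * j) ` (mod_roots f p \<times> {0..<int p})"
    proof
      fix n assume n: "n \<in> mod_roots f (p\<^sup>2)"
      have "0 \<le> n" "n < int p * int p" using n by (auto simp: mod_roots_def power2_eq_square)
      moreover have "int p * (n div int p) \<le> n"
        using mult_div_mod_eq[of "int p" n] pos_mod_sign[of "int p" n] p0 by linarith
      ultimately have "int p * (n div int p) < int p * int p" by linarith
      hence "n div int p \<in> {0..<int p}" using p0 \<open>0 \<le> n\<close>
        by (auto simp: pos_imp_zdiv_nonneg_iff)
      thus "n \<in> (\<lambda>(r, j). r + int p * j) ` (mod_roots f p \<times> {0..<int p})"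
        using red[OF n] by (intro image_eqI[of _ _ "(n mod int p, n div int p)"]) auto
    qed
    hence "card (mod_roots f (p\<^sup>2)) \<le> card (mod_roots f p \<times> {0..<int p})"
      by (intro surj_card_le) auto
    also have "\<dots> \<le> k * p" using k by (simp add: card_cartesian_product root_count_eq)
    finally show ?thesis using True by (simp add: root_count_eq gcd_nat.absorb1)
  next
    case False
    hence nd: "\<not> int p dvd \<Delta>" by (metis dvd_abs_iff int_dvd_int_iff nat_0_le abs_ge_zero)
    \<comment> \<open>Two lifts of one root differ by a multiple \<open>h\<close> of
      \<open>p\<close>. Modulo the square of \<open>p\<close>, Taylor's formula leaves only
      \<open>h\<close> times the derivative at \<open>x\<close>, and \<open>p\<close> does not
      divide that derivative, since it would then divide \<open>\<Delta>\<close>.\<close>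
    have "inj_on (\<lambda>n. n mod int p) (mod_roots f (p\<^sup>2))"
    proof (rule inj_onI)
      fix x y assume xy: "x \<in> mod_roots f (p\<^sup>2)" "y \<in> mod_roots f (p\<^sup>2)" "x mod int p = y mod int p"
      define h where "h = y - x"
      have ph: "int p dvd h" using xy(3) unfolding h_def by (metis mod_eq_dvd_iff)
      obtain t where t: "poly f (x + h) = poly f x + h * poly (pderiv f) x + h\<^sup>2 * t"
        using poly_taylor_second_order by blast
      have px: "(int p)\<^sup>2 dvd poly f x" "(int p)\<^sup>2 dvd poly f (x + h)"
        using xy by (auto simp: mod_roots_def cong_0_iff h_def)
      moreover have "(int p)\<^sup>2 dvd h\<^sup>2 * t" using ph by (simp add: dvd_power_same)
      moreover have "h * poly (pderiv f) x = poly f (x + h) - poly f x - h\<^sup>2 * t" using t by simp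
      ultimately have d: "(int p)\<^sup>2 dvd h * poly (pderiv f) x" by (metis dvd_diff)
      have "\<not> int p dvd poly (pderiv f) x"
      proof
        assume "int p dvd poly (pderiv f) x"
        moreover have "int p dvd poly f x" using px(1) by (metis dvd_trans dvd_power pos2)
        moreover have "poly u x * poly f x + poly v x * poly (pderiv f) x = \<Delta>"
          using arg_cong[OF uv, of "\<lambda>q. poly q x"] by simp
        ultimately have "int p dvd \<Delta>" by (metis dvd_add dvd_mult)
        thus False using nd by simp
      qed
      hence "coprime ((int p)\<^sup>2) (poly (pderiv f) x)"
        using p by (simp add: prime_imp_coprime)
      hence "(int p)\<^sup>2 dvd h" using d by (simp add: coprime_dvd_mult_left_iff)
      hence "[x = y] (mod (int p)\<^sup>2)" by (simp add: cong_iff_dvd_diff h_def dvd_diff_commute)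
      thus "x = y" using xy by (auto simp: mod_roots_def cong_def)
    qed
    moreover have "(\<lambda>n. n mod int p) ` mod_roots f (p\<^sup>2) \<subseteq> mod_roots f p" using red by auto
    ultimately have "card (mod_roots f (p\<^sup>2)) \<le> card (mod_roots f p)"
      by (rule card_inj_on_le) auto
    moreover have "gcd p (nat \<bar>\<Delta>\<bar>) = 1" using False p prime_imp_coprime coprime_iff_gcd_eq_1 by blast
    ultimately show ?thesis using k by (simp add: root_count_eq)
  qed
qed

lemma root_count_squarefree_square_le:
  fixes f u v :: "int poly" and d :: nat
  assumes d: "squarefree d" and f: "content f = 1" "degree f \<le> k"
    and uv: "u * f + v * pderiv f = [:\<Delta>:]"
  shows "root_count f (d\<^sup>2) \<le> k ^ card (prime_factors d) * gcd d (nat \<bar>\<Delta>\<bar>)"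
proof -
  have "root_count f ((\<Prod>T)\<^sup>2) \<le> k ^ card T * gcd (\<Prod>T) (nat \<bar>\<Delta>\<bar>)"
    if "finite T" "\<And>p. p \<in> T \<Longrightarrow> prime p" for T :: "nat set"
    using that
  proof (induction T rule: finite_induct)
    case empty
    thus ?case by (simp add: root_count_1)
  next
    case (insert p T)
    have pr: "prime p" using insert by auto
    have cop: "coprime p (\<Prod>T)"
      using insert by (intro prod_coprime_right) (auto intro!: primes_coprime)
    have pos: "p * \<Prod>T > 0" using insert.prems by (auto intro!: prod_pos simp: prime_gt_0_nat)
    have "root_count f ((\<Prod>(insert p T))\<^sup>2) = root_count f (p\<^sup>2) * root_count f ((\<Prod>T)\<^sup>2)"
      using insert root_count_prod_primes_square[of "insert p T" f]
        root_count_prod_primes_square[of T f] by simp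
    also have "\<dots> \<le> (k * gcd p (nat \<bar>\<Delta>\<bar>)) * (k ^ card T * gcd (\<Prod>T) (nat \<bar>\<Delta>\<bar>))"
      using insert by (intro mult_le_mono root_count_prime_square_le[OF pr f uv]) auto
    also have "\<dots> = k ^ Suc (card T) * (gcd p (nat \<bar>\<Delta>\<bar>) * gcd (\<Prod>T) (nat \<bar>\<Delta>\<bar>))" by simp
    \<comment> \<open>The two gcds are coprime and both divide the gcd on the right, hence so does
      their product.\<close>
    also have "gcd p (nat \<bar>\<Delta>\<bar>) * gcd (\<Prod>T) (nat \<bar>\<Delta>\<bar>) \<le> gcd (p * \<Prod>T) (nat \<bar>\<Delta>\<bar>)"
    proof (rule dvd_imp_le)
      have "coprime (gcd p (nat \<bar>\<Delta>\<bar>)) (gcd (\<Prod>T) (nat \<bar>\<Delta>\<bar>))"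
        using cop by (meson coprime_divisors gcd_dvd1)
      moreover have "gcd p (nat \<bar>\<Delta>\<bar>) dvd gcd (p * \<Prod>T) (nat \<bar>\<Delta>\<bar>)"
        by (rule gcd_mono) (rule dvd_triv_left dvd_refl)+
      moreover have "gcd (\<Prod>T) (nat \<bar>\<Delta>\<bar>) dvd gcd (p * \<Prod>T) (nat \<bar>\<Delta>\<bar>)"
        by (rule gcd_mono) (rule dvd_triv_right dvd_refl)+
      ultimately show "gcd p (nat \<bar>\<Delta>\<bar>) * gcd (\<Prod>T) (nat \<bar>\<Delta>\<bar>) dvd gcd (p * \<Prod>T) (nat \<bar>\<Delta>\<bar>)"
        by (rule divides_mult[rotated 2])
      show "gcd (p * \<Prod>T) (nat \<bar>\<Delta>\<bar>) > 0" using pos by (intro gcd_pos_nat[THEN iffD2]) auto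
    qed
    finally show ?case using insert by (simp add: mult_left_mono)
  qed
  from this[of "prime_factors d"] show ?thesis
    using prod_prime_factors_squarefree[OF d] by auto
qed

section \<open>Polynomials in a box\<close>

text \<open>Coprimality over the rationals is expressed as the absence of a common complex zero.
  This condition passes easily through a division step, and by the fundamental theorem of algebra a
  polynomial without zeros is a nonzero constant.\<close>

definition ceval :: "int poly \<Rightarrow> complex \<Rightarrow> complex" where
  "ceval f z = poly (map_poly of_int f) z"

lemma ceval_pCons [simp]: "ceval (pCons a p) z = of_int a + z * ceval p z"
  by (cases "a = 0 \<and> p = 0") (auto simp: ceval_def map_poly_pCons)

lemma ceval_0 [simp]: "ceval 0 z = 0"
  by (simp add: ceval_def)

lemma ceval_smult [simp]: "ceval (smult c p) z = of_int c * ceval p z"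
  by (induction p) (auto simp: algebra_simps)

lemma ceval_add [simp]: "ceval (p + q) z = ceval p z + ceval q z"
  by (induction p q rule: poly_induct2) (auto simp: algebra_simps)

lemma ceval_diff [simp]: "ceval (p - q) z = ceval p z - ceval q z"
  using ceval_add[of "p - q" q z] by simp

lemma ceval_mult [simp]: "ceval (p * q) z = ceval p z * ceval q z"
  by (induction p) (auto simp: algebra_simps)

lemma card_ceval_roots_le:
  assumes "p \<noteq> 0"
  shows "finite {z. ceval p z = 0}" "card {z. ceval p z = 0} \<le> degree p"
proof -
  have nz: "map_poly of_int p \<noteq> (0 :: complex poly)"
    using assms by (metis coeff_map_poly coeff_0 of_int_0 of_int_eq_0_iff poly_eqI)
  have deg: "degree (map_poly of_int p :: complex poly) = degree p" by (rule degree_map_poly) auto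
  show "finite {z. ceval p z = 0}" unfolding ceval_def using nz by (rule poly_roots_finite)
  show "card {z. ceval p z = 0} \<le> degree p"
    unfolding ceval_def using card_poly_roots_bound[OF nz] deg by simp
qed

lemma ceval_root_exists:
  assumes "degree p \<noteq> 0"
  shows "\<exists>z. ceval p z = 0"
proof -
  have deg: "degree (map_poly of_int p :: complex poly) = degree p" by (rule degree_map_poly) auto
  have "\<not> constant (poly (map_poly of_int p :: complex poly))"
    using assms deg by (simp add: constant_degree)
  thus ?thesis unfolding ceval_def by (rule fundamental_theorem_of_algebra)
qed

text \<open>A nonzero constant \<open>f\<close> serves as \<open>\<Delta>\<close> itself. If
  \<open>f = 0\<close>, then \<open>g\<close> has no complex zero, so \<open>g\<close> is a nonzero
  constant and serves instead.\<close>

lemma bezout_constant_degree_0: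
  fixes f g :: "int poly" and H :: int
  assumes "degree f = 0" "\<And>i. \<bar>coeff f i\<bar> \<le> H" "\<And>i. \<bar>coeff g i\<bar> \<le> H"
    and "\<And>z. \<not> (ceval f z = 0 \<and> ceval g z = 0)"
  shows "\<exists>\<Delta> u v. \<Delta> \<noteq> 0 \<and> \<bar>\<Delta>\<bar> \<le> H \<and> u * f + v * g = [:\<Delta>:]"
proof -
  obtain c where c: "f = [:c:]" using assms(1) by (auto elim: degree_eq_zeroE)
  show ?thesis
  proof (cases "c = 0")
    case False
    hence "c \<noteq> 0 \<and> \<bar>c\<bar> \<le> H \<and> 1 * f + 0 * g = [:c:]" using c assms(2)[of 0] by simp
    thus ?thesis by blast
  next
    case True
    hence "\<not> (\<exists>z. ceval g z = 0)" using assms(4) c by simp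
    then obtain c' where c': "g = [:c':]"
      using ceval_root_exists[of g] by (auto elim: degree_eq_zeroE)
    hence "c' \<noteq> 0" using assms(4)[of 0] c True by auto
    hence "c' \<noteq> 0 \<and> \<bar>c'\<bar> \<le> H \<and> 0 * f + 1 * g = [:c':]" using c' assms(3)[of 0] by simp
    thus ?thesis by blast
  qed
qed

text \<open>One step of pseudo-division squares the coefficient bound and lowers the sum of the
  degrees; iterating bounds a nonzero constant of the ideal without resultants.\<close>

lemma pseudo_division_step:
  fixes f g :: "int poly" and H :: int
  assumes "degree g \<le> degree f" "degree g > 0"
    and "\<And>i. \<bar>coeff f i\<bar> \<le> H" "\<And>i. \<bar>coeff g i\<bar> \<le> H"
  defines "r \<equiv> smult (lead_coeff g) f - monom (lead_coeff f) (degree f - degree g) * g"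
  shows "degree r < degree f" "\<bar>coeff r i\<bar> \<le> 2 * H\<^sup>2"
    "ceval r z = 0 \<Longrightarrow> ceval g z = 0 \<Longrightarrow> ceval f z = 0"
proof -
  have le: "degree r \<le> degree f" unfolding r_def
  proof (rule degree_diff_le)
    have "degree (monom (lead_coeff f) (degree f - degree g) * g) \<le> (degree f - degree g) + degree g"
      by (rule order.trans[OF degree_mult_le]) (simp add: degree_monom_le)
    thus "degree (monom (lead_coeff f) (degree f - degree g) * g) \<le> degree f" using assms(1) by simp
  qed simp
  have "coeff r (degree f) = 0"
    unfolding r_def using assms(1) by (simp add: coeff_monom_mult)
  with le have "r = 0 \<or> degree r < degree f" by (rule eq_zero_or_degree_less)
  thus "degree r < degree f" using assms(1,2) by auto
  have H0: "H \<ge> 0" using assms(3)[of 0] by linarith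
  have prod: "\<bar>a * b\<bar> \<le> H\<^sup>2" if "\<bar>a\<bar> \<le> H" "\<bar>b\<bar> \<le> H" for a b
    unfolding abs_mult power2_eq_square using that H0 by (intro mult_mono) auto
  have "\<bar>coeff r i\<bar> \<le> \<bar>lead_coeff g * coeff f i\<bar>
      + \<bar>if i < degree f - degree g then 0 else lead_coeff f * coeff g (i - (degree f - degree g))\<bar>"
    unfolding r_def by (simp add: coeff_monom_mult abs_triangle_ineq4)
  also have "\<dots> \<le> H\<^sup>2 + H\<^sup>2"
    using prod[of "lead_coeff g" "coeff f i"] prod[of "lead_coeff f" "coeff g (i - (degree f - degree g))"]
      assms(3,4) by (intro add_mono) auto
  finally show "\<bar>coeff r i\<bar> \<le> 2 * H\<^sup>2" by simp
  assume "ceval r z = 0" "ceval g z = 0"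
  hence "of_int (lead_coeff g) * ceval f z = 0" unfolding r_def by simp
  thus "ceval f z = 0" using assms(2) by auto
qed

text \<open>Induction on a bound for the sum of the degrees: the polynomial of larger degree is
  replaced by its pseudo-remainder. The remainder lies in the same ideal, and a common zero of
  remainder and divisor would be a common zero of the original pair.\<close>

lemma bezout_constant_bound:
  fixes f g :: "int poly" and H :: int
  assumes "degree f + degree g \<le> s" "H \<ge> 1"
    and "\<And>i. \<bar>coeff f i\<bar> \<le> H" "\<And>i. \<bar>coeff g i\<bar> \<le> H"
    and "\<And>z. \<not> (ceval f z = 0 \<and> ceval g z = 0)"
  shows "\<exists>\<Delta> u v. \<Delta> \<noteq> 0 \<and> \<bar>\<Delta>\<bar> \<le> (2 * H) ^ (2 ^ s) \<and> u * f + v * g = [:\<Delta>:]"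
  using assms
proof (induction s arbitrary: f g H)
  case 0
  obtain \<Delta> u v where *: "\<Delta> \<noteq> 0" "\<bar>\<Delta>\<bar> \<le> H" "u * f + v * g = [:\<Delta>:]"
    using bezout_constant_degree_0[of f H g] 0 by auto
  show ?case
    by (rule exI[of _ \<Delta>], rule exI[of _ u], rule exI[of _ v]) (use * 0 in auto)
next
  case (Suc s)
  have "H \<le> 2 * H" using Suc.prems by simp
  also have "\<dots> \<le> (2 * H) ^ (2 ^ Suc s)" using Suc.prems by (intro self_le_power) auto
  finally have HB: "H \<le> (2 * H) ^ (2 ^ Suc s)" .
  \<comment> \<open>With the new coefficient bound \<open>2 * H\<^sup>2\<close>, the quantity
    \<open>2 * H\<close> turns into its own square. This is the source of the exponent
    \<open>2 ^ s\<close>.\<close>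
  have sq: "(2 * (2 * H\<^sup>2)) ^ (2 ^ s) = (2 * H) ^ (2 ^ Suc s)"
    by (simp add: power_mult power_mult_distrib)
  have H2: "2 * H\<^sup>2 \<ge> 1" "H \<le> 2 * H\<^sup>2" 
    using Suc.prems(2) self_le_power[of H 2] by auto
  consider "degree f = 0" | "degree g = 0" | "degree g > 0" "degree g \<le> degree f"
    | "degree f > 0" "degree f \<le> degree g" by linarith
  thus ?case
  proof cases
    case 1
    obtain \<Delta> u v where "\<Delta> \<noteq> 0" "\<bar>\<Delta>\<bar> \<le> H" "u * f + v * g = [:\<Delta>:]"
      using bezout_constant_degree_0[of f H g] 1 Suc.prems by auto
    moreover from this have "\<bar>\<Delta>\<bar> \<le> (2 * H) ^ (2 ^ Suc s)" using HB by linarith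
    ultimately show ?thesis by blast
  next
    case 2
    have "\<not> (ceval g z = 0 \<and> ceval f z = 0)" for z using Suc.prems(5)[of z] by auto
    from bezout_constant_degree_0[OF 2 Suc.prems(4,3) this]
    obtain \<Delta> u v where "\<Delta> \<noteq> 0" "\<bar>\<Delta>\<bar> \<le> H" "u * g + v * f = [:\<Delta>:]" by auto
    moreover from this have "\<bar>\<Delta>\<bar> \<le> (2 * H) ^ (2 ^ Suc s)" "v * f + u * g = [:\<Delta>:]"
      using HB by (linarith, simp add: add.commute)
    ultimately show ?thesis by blast
  next
    case 3
    define m where "m = monom (lead_coeff f) (degree f - degree g)"
    define r where "r = smult (lead_coeff g) f - m * g"
    note step = pseudo_division_step[OF 3(2,1) Suc.prems(3,4), folded m_def, folded r_def]
    have "\<exists>\<Delta> u v. \<Delta> \<noteq> 0 \<and> \<bar>\<Delta>\<bar> \<le> (2 * (2 * H\<^sup>2)) ^ (2 ^ s) \<and> u * r + v * g = [:\<Delta>:]"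
    proof (rule Suc.IH)
      show "degree r + degree g \<le> s" using step(1) Suc.prems(1) by simp
      show "\<bar>coeff g i\<bar> \<le> 2 * H\<^sup>2" for i using Suc.prems(4)[of i] H2 by linarith
      show "\<not> (ceval r z = 0 \<and> ceval g z = 0)" for z using step(3)[of z] Suc.prems(5)[of z] by auto
    qed (rule H2 step(2))+
    then obtain \<Delta> u v where *: "\<Delta> \<noteq> 0" "\<bar>\<Delta>\<bar> \<le> (2 * H) ^ (2 ^ Suc s)" "u * r + v * g = [:\<Delta>:]"
      unfolding sq by blast
    have "smult (lead_coeff g) u * f + (v - u * m) * g = [:\<Delta>:]"
      using *(3) unfolding r_def by (simp add: algebra_simps)
    thus ?thesis using * by blast
  next
    case 4
    define m where "m = monom (lead_coeff g) (degree g - degree f)"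
    define r where "r = smult (lead_coeff f) g - m * f"
    note step = pseudo_division_step[OF 4(2,1) Suc.prems(4,3), folded m_def, folded r_def]
    have "\<exists>\<Delta> u v. \<Delta> \<noteq> 0 \<and> \<bar>\<Delta>\<bar> \<le> (2 * (2 * H\<^sup>2)) ^ (2 ^ s) \<and> u * f + v * r = [:\<Delta>:]"
    proof (rule Suc.IH)
      show "degree f + degree r \<le> s" using step(1) Suc.prems(1) by simp
      show "\<bar>coeff f i\<bar> \<le> 2 * H\<^sup>2" for i using Suc.prems(3)[of i] H2 by linarith
      show "\<not> (ceval f z = 0 \<and> ceval r z = 0)" for z using step(3)[of z] Suc.prems(5)[of z] by auto
    qed (rule H2 step(2))+
    then obtain \<Delta> u v where *: "\<Delta> \<noteq> 0" "\<bar>\<Delta>\<bar> \<le> (2 * H) ^ (2 ^ Suc s)" "u * f + v * r = [:\<Delta>:]"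
      unfolding sq by blast
    have "(u - v * m) * f + smult (lead_coeff f) v * g = [:\<Delta>:]"
      using *(3) unfolding r_def by (simp add: algebra_simps)
    thus ?thesis using * by blast
  qed
qed

section \<open>Separable polynomials and the box of bounded coefficients\<close>

text \<open>Nonzero constants count as separable, whereas the zero polynomial does not.\<close>

definition separable_poly :: "int poly \<Rightarrow> bool" where
  "separable_poly f \<longleftrightarrow> (\<forall>z. \<not> (ceval f z = 0 \<and> ceval (pderiv f) z = 0))"

text \<open>The gcd condition is left out so that the coefficients range independently and the box
  can be built up one coefficient at a time; primitivity is added separately as
  \<open>content f = 1\<close>.\<close>

definition box_polys :: "nat \<Rightarrow> int \<Rightarrow> int poly set" where
  "box_polys k H = {f. degree f \<le> k \<and> (\<forall>i. \<bar>coeff f i\<bar> \<le> H)}"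

text \<open>The degrees of \<open>f\<close> and its derivative add up to at most
  \<open>2 * k\<close>, and the coefficients of the derivative are at most \<open>k * H\<close>;
  this explains the shape of the bound, which is polynomial in \<open>H\<close> for fixed
  \<open>k\<close>.\<close>

lemma separable_poly_bezout:
  assumes f: "f \<in> box_polys k H" "separable_poly f" and "k \<ge> 1" "H \<ge> 1"
  shows "\<exists>\<Delta> u v. \<Delta> \<noteq> 0 \<and> \<bar>\<Delta>\<bar> \<le> (2 * int k * H) ^ (2 ^ (2 * k)) \<and> u * f + v * pderiv f = [:\<Delta>:]"
proof -
  have c: "\<bar>coeff f i\<bar> \<le> H" for i using f by (auto simp: box_polys_def)
  have kH: "H \<le> int k * H" using assms by simp
  have d: "\<bar>coeff (pderiv f) i\<bar> \<le> int k * H" for i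
  proof (cases "Suc i \<le> degree f")
    case True
    have "\<bar>coeff (pderiv f) i\<bar> = int (Suc i) * \<bar>coeff f (Suc i)\<bar>"
      by (simp add: coeff_pderiv abs_mult)
    also have "\<dots> \<le> int k * H" using True f c by (intro mult_mono) (auto simp: box_polys_def)
    finally show ?thesis .
  next
    case False
    thus ?thesis using kH assms by (simp add: coeff_pderiv coeff_eq_0)
  qed
  have "\<exists>\<Delta> u v. \<Delta> \<noteq> 0 \<and> \<bar>\<Delta>\<bar> \<le> (2 * (int k * H)) ^ (2 ^ (2 * k)) \<and> u * f + v * pderiv f = [:\<Delta>:]"
  proof (rule bezout_constant_bound)
    show "degree f + degree (pderiv f) \<le> 2 * k"
      using f by (auto simp: box_polys_def degree_pderiv)
    show "\<bar>coeff f i\<bar> \<le> int k * H" for i using c[of i] kH by linarith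
    show "int k * H \<ge> 1" using kH assms by linarith
  qed (use d f in \<open>auto simp: separable_poly_def\<close>)
  thus ?thesis by (simp add: mult.assoc)
qed

lemma box_polys_0: "H \<ge> 0 \<Longrightarrow> box_polys 0 H = (\<lambda>c. [:c:]) ` {-H..H}"
proof (intro equalityI subsetI)
  fix f assume "f \<in> box_polys 0 H"
  hence "degree f = 0" "\<bar>coeff f 0\<bar> \<le> H" by (auto simp: box_polys_def)
  then obtain c where "f = [:c:]" "\<bar>coeff f 0\<bar> \<le> H" by (auto elim: degree_eq_zeroE)
  thus "f \<in> (\<lambda>c. [:c:]) ` {-H..H}" by (intro image_eqI[of _ _ c]) auto
qed (auto simp: box_polys_def coeff_pCons split: nat.split)

lemma pCons_in_box_polys:
  "H \<ge> 0 \<Longrightarrow> pCons c g \<in> box_polys (Suc k) H \<longleftrightarrow> \<bar>c\<bar> \<le> H \<and> g \<in> box_polys k H"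
proof
  assume H: "H \<ge> 0" and f: "pCons c g \<in> box_polys (Suc k) H"
  have "\<bar>coeff (pCons c g) i\<bar> \<le> H" for i using f by (auto simp: box_polys_def)
  from this[of 0] this[of "Suc _"] show "\<bar>c\<bar> \<le> H \<and> g \<in> box_polys k H"
    using f by (auto simp: box_polys_def degree_pCons_eq_if split: if_splits)
next
  assume "H \<ge> 0" "\<bar>c\<bar> \<le> H \<and> g \<in> box_polys k H"
  thus "pCons c g \<in> box_polys (Suc k) H"
    by (auto simp: box_polys_def coeff_pCons degree_pCons_eq_if split: nat.split)
qed

lemma bij_betw_pCons_box_polys:
  assumes "H \<ge> 0"
  shows "bij_betw (\<lambda>(g, c). pCons c g) (box_polys k H \<times> {-H..H}) (box_polys (Suc k) H)"
proof (rule bij_betw_imageI)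
  show "inj_on (\<lambda>(g, c). pCons c g) (box_polys k H \<times> {-H..H})" by (auto intro!: inj_onI)
  show "(\<lambda>(g, c). pCons c g) ` (box_polys k H \<times> {-H..H}) = box_polys (Suc k) H"
  proof (intro equalityI subsetI)
    fix f assume f: "f \<in> box_polys (Suc k) H"
    obtain c g where cg: "f = pCons c g" by (cases f)
    hence "\<bar>c\<bar> \<le> H \<and> g \<in> box_polys k H" using f assms pCons_in_box_polys by blast
    thus "f \<in> (\<lambda>(g, c). pCons c g) ` (box_polys k H \<times> {-H..H})" using cg by force
  qed (use assms in \<open>auto simp: pCons_in_box_polys\<close>)
qed

lemma finite_box_polys: "H \<ge> 0 \<Longrightarrow> finite (box_polys k H)"
proof (induction k)
  case (Suc k)
  thus ?case using bij_betw_finite[OF bij_betw_pCons_box_polys[of H k]] by simp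
qed (simp add: box_polys_0)

text \<open>Fubini for the constant coefficient: it allows counting constant terms while the other
  coefficients are fixed.\<close>

lemma sum_box_polys_Suc:
  assumes "H \<ge> 0"
  shows "sum \<phi> (box_polys (Suc k) H) = (\<Sum>g\<in>box_polys k H. \<Sum>c\<in>{-H..H}. \<phi> (pCons c g))"
  unfolding sum.reindex_bij_betw[OF bij_betw_pCons_box_polys[OF assms], symmetric]
  by (simp add: sum.cartesian_product case_prod_unfold)

lemma card_box_polys: "H \<ge> 0 \<Longrightarrow> card (box_polys k H) = nat (2 * H + 1) ^ Suc k"
proof (induction k)
  case 0
  have "card ((\<lambda>c. [:c:]) ` {-H..H}) = card {-H..H}" by (intro card_image inj_onI) simp
  thus ?case using 0 by (simp add: box_polys_0)
next
  case (Suc k)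
  have "card (box_polys (Suc k) H) = card (box_polys k H \<times> {-H..H})"
    using bij_betw_same_card[OF bij_betw_pCons_box_polys[OF Suc.prems]] by simp
  thus ?case using Suc by (simp add: card_cartesian_product algebra_simps)
qed

text \<open>The gcd of a tuple and the content of its polynomial have the same divisors and are both
  normalized, hence equal. The tuple is recovered by restricting the coefficient function to
  \<open>{0..k}\<close>.\<close>

lemma primitive_polys_eq:
  "primitive_polys k H = {f \<in> box_polys k H. content f = 1}" if "H \<ge> 0"
proof -
  have co: "coeff (\<Sum>i=0..k. monom (a i) i) n = (if n \<le> k then a n else 0)" for a :: "nat \<Rightarrow> int" and n
  proof -
    have "coeff (\<Sum>i=0..k. monom (a i) i) n = (\<Sum>i=0..k. if i = n then a i else 0)"
      by (simp add: coeff_sum)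
    thus ?thesis by (simp add: sum.delta')
  qed
  have ct: "content (\<Sum>i=0..k. monom (a i) i) = Gcd (a ` {0..k})" for a :: "nat \<Rightarrow> int"
  proof (rule associated_eqI)
    let ?f = "\<Sum>i=0..k. monom (a i) i"
    have iff: "c dvd content ?f \<longleftrightarrow> c dvd Gcd (a ` {0..k})" for c
    proof -
      have "c dvd content ?f \<longleftrightarrow> (\<forall>n. c dvd coeff ?f n)"
        by (simp only: const_poly_dvd_iff_dvd_content[symmetric] const_poly_dvd_iff)
      also have "\<dots> \<longleftrightarrow> c dvd Gcd (a ` {0..k})" by (auto simp: co dvd_Gcd_iff)
      finally show ?thesis .
    qed
    show "content ?f dvd Gcd (a ` {0..k})" by (rule iffD1[OF iff dvd_refl])
    show "Gcd (a ` {0..k}) dvd content ?f" by (rule iffD2[OF iff dvd_refl])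
  qed (simp_all add: normalize_content del: normalize_int_def)
  show ?thesis
  proof (intro equalityI subsetI)
    fix f assume "f \<in> primitive_polys k H"
    then obtain a where a: "a \<in> primitive_tuples k H" "f = (\<Sum>i=0..k. monom (a i) i)"
      by (auto simp: primitive_polys_def)
    have "degree f \<le> k" unfolding a(2)
      by (rule degree_le) (simp add: co)
    thus "f \<in> {f \<in> box_polys k H. content f = 1}"
      using a that by (auto simp: box_polys_def primitive_tuples_def ct co)
  next
    fix f assume f: "f \<in> {f \<in> box_polys k H. content f = 1}"
    define a where "a = restrict (coeff f) {0..k}"
    have "f = (\<Sum>i=0..k. monom (a i) i)"
      by (rule poly_eqI) (use f in \<open>auto simp: co a_def box_polys_def coeff_eq_0\<close>)
    moreover from this have "a \<in> primitive_tuples k H"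
      using f ct[of a] by (auto simp: primitive_tuples_def a_def box_polys_def)
    ultimately show "f \<in> primitive_polys k H" by (auto simp: primitive_polys_def)
  qed
qed

text \<open>The derivative does not depend on the constant term \<open>c\<close>. A common zero
  \<open>z\<close> is thus one of at most \<open>k\<close> zeros of a fixed polynomial, and
  \<open>z\<close> determines \<open>c\<close> as \<open>- z * ceval g z\<close>.\<close>

lemma card_nonseparable_pCons_le:
  assumes "g \<in> box_polys k H"
  shows "finite {c. content (pCons c g) = 1 \<and> \<not> separable_poly (pCons c g)}"
    "card {c. content (pCons c g) = 1 \<and> \<not> separable_poly (pCons c g)} \<le> k"
proof -
  let ?B = "{c. content (pCons c g) = 1 \<and> \<not> separable_poly (pCons c g)}"
  have "finite ?B \<and> card ?B \<le> k"
  proof (cases "g = 0")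
    case True
    \<comment> \<open>For \<open>g = 0\<close> the derivative vanishes identically, but content 1
      forces \<open>c\<close> to be nonzero.\<close>
    have "separable_poly [:c:]" if "c \<noteq> 0" for c
      using that by (simp add: separable_poly_def)
    hence "?B = {}" using True by auto
    thus ?thesis by (metis card.empty finite.emptyI le0)
  next
    case False
    define q where "q = pderiv (pCons 0 g)"
    have q: "pderiv (pCons c g) = q" for c by (simp add: q_def pderiv_pCons)
    have "q \<noteq> 0" unfolding q_def using False by (simp add: pderiv_eq_0_iff)
    note roots = card_ceval_roots_le[OF this]
    have "degree q \<le> k" using assms False by (simp add: q_def degree_pderiv box_polys_def)
    have sub: "(of_int :: int \<Rightarrow> complex) ` ?B \<subseteq> (\<lambda>z. - z * ceval g z) ` {z. ceval q z = 0}"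
    proof
      fix w :: complex assume "w \<in> of_int ` ?B"
      then obtain c where c: "w = of_int c" "\<not> separable_poly (pCons c g)" by auto
      then obtain z where z: "of_int c + z * ceval g z = 0" "ceval q z = 0"
        by (auto simp: separable_poly_def q)
      hence "w = - z * ceval g z" using c by (simp add: eq_neg_iff_add_eq_0)
      thus "w \<in> (\<lambda>z. - z * ceval g z) ` {z. ceval q z = 0}" using z by blast
    qed
    have inj: "inj_on (of_int :: int \<Rightarrow> complex) ?B" by (auto intro!: inj_onI)
    have "finite ?B" using sub roots(1) inj by (meson finite_imageD finite_imageI finite_subset)
    moreover have "card ?B = card ((of_int :: int \<Rightarrow> complex) ` ?B)" using card_image[OF inj] by simp
    moreover have "\<dots> \<le> card {z. ceval q z = 0}"
      using sub roots(1) by (meson surj_card_le)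
    ultimately show ?thesis using roots(2) \<open>degree q \<le> k\<close> by linarith
  qed
  thus "finite ?B" "card ?B \<le> k" by auto
qed

lemma card_nonseparable_le:
  assumes "H \<ge> 0"
  shows "card {f \<in> box_polys (Suc k) H. content f = 1 \<and> \<not> separable_poly f}
    \<le> k * nat (2 * H + 1) ^ Suc k"
proof -
  let ?P = "\<lambda>f. content f = 1 \<and> \<not> separable_poly f"
  have "card {f \<in> box_polys (Suc k) H. ?P f} = (\<Sum>f\<in>box_polys (Suc k) H. if ?P f then 1 else 0)"
    using finite_box_polys[OF assms] by (simp add: sum.If_cases Int_def)
  also have "\<dots> = (\<Sum>g\<in>box_polys k H. \<Sum>c\<in>{-H..H}. if ?P (pCons c g) then 1 else 0)"
    by (rule sum_box_polys_Suc[OF assms])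
  also have "\<dots> \<le> (\<Sum>g\<in>box_polys k H. k)"
  proof (rule sum_mono)
    fix g assume g: "g \<in> box_polys k H"
    have "(\<Sum>c\<in>{-H..H}. if ?P (pCons c g) then 1 else 0) = card {c \<in> {-H..H}. ?P (pCons c g)}"
      by (simp add: sum.If_cases Int_def)
    also have "\<dots> \<le> card {c. ?P (pCons c g)}"
      using card_nonseparable_pCons_le[OF g] by (intro card_mono) auto
    also have "\<dots> \<le> k" using card_nonseparable_pCons_le[OF g] by simp
    finally show "(\<Sum>c\<in>{-H..H}. if ?P (pCons c g) then 1 else 0) \<le> k" .
  qed
  also have "\<dots> = k * nat (2 * H + 1) ^ Suc k" using card_box_polys[OF assms, of k] by simp
  finally show ?thesis .
qed

section \<open>Truncation of the squarefree indicator\<close>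

lemma card_residue_class_interval:
  fixes q H r :: int
  assumes "q > 0" "H \<ge> 0"
  shows "\<bar>real (card {c \<in> {-H..H}. q dvd c + r}) - 2 * real_of_int H / real_of_int q\<bar> \<le> 1"
proof -
  define x y where "x = real_of_int (r - H) / real_of_int q" and "y = real_of_int (r + H) / real_of_int q"
  have "{c \<in> {-H..H}. q dvd c + r} = (\<lambda>t. q * t - r) ` {\<lceil>x\<rceil>..\<lfloor>y\<rfloor>}"
  proof (intro equalityI subsetI)
    fix c assume c: "c \<in> {c \<in> {-H..H}. q dvd c + r}"
    then obtain t where t: "c + r = q * t" by (auto elim: dvdE)
    have "r - H \<le> q * t" "q * t \<le> r + H" using c t[symmetric] by auto
    hence "real_of_int (r - H) \<le> real_of_int (q * t)" "real_of_int (q * t) \<le> real_of_int (r + H)"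
      by (simp_all only: of_int_le_iff)
    hence "x \<le> real_of_int t" "real_of_int t \<le> y"
      using assms by (auto simp: x_def y_def field_simps)
    thus "c \<in> (\<lambda>t. q * t - r) ` {\<lceil>x\<rceil>..\<lfloor>y\<rfloor>}"
      using t by (intro image_eqI[of _ _ t]) (auto simp: ceiling_le_iff le_floor_iff)
  next
    fix c assume "c \<in> (\<lambda>t. q * t - r) ` {\<lceil>x\<rceil>..\<lfloor>y\<rfloor>}"
    then obtain t where t: "c = q * t - r" "t \<in> {\<lceil>x\<rceil>..\<lfloor>y\<rfloor>}" by blast
    hence "x \<le> real_of_int t" "real_of_int t \<le> y" by (simp_all add: ceiling_le_iff le_floor_iff)
    hence "real_of_int (r - H) \<le> real_of_int (q * t)" "real_of_int (q * t) \<le> real_of_int (r + H)"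
      using assms by (auto simp: x_def y_def field_simps)
    hence "r - H \<le> q * t" "q * t \<le> r + H" by (simp_all only: of_int_le_iff)
    thus "c \<in> {c \<in> {-H..H}. q dvd c + r}" using t by auto
  qed
  moreover have "inj_on (\<lambda>t. q * t - r) {\<lceil>x\<rceil>..\<lfloor>y\<rfloor>}" using assms by (auto intro!: inj_onI)
  ultimately have "card {c \<in> {-H..H}. q dvd c + r} = nat (\<lfloor>y\<rfloor> - \<lceil>x\<rceil> + 1)"
    by (simp add: card_image)
  moreover have yx: "y - x = 2 * real_of_int H / real_of_int q"
    using assms by (simp add: x_def y_def field_simps)
  \<comment> \<open>Since the interval is not reversed, floor minus ceiling plus one exceeds -1, so
    \<open>nat\<close> does not cut anything off.\<close>
  moreover have "y - x \<ge> 0" unfolding yx using assms by simp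
  ultimately show ?thesis by linarith
qed

text \<open>The prescribed value fixes the constant term modulo \<open>n\<close>, and the constant
  term then fixes the value at \<open>n\<close> of the polynomial formed by the other coefficients.
  Each induction step therefore costs the size of one residue class in
  \<open>{-H..H}\<close>.\<close>

lemma card_box_polys_value_le:
  fixes n :: nat and H v :: int
  assumes "1 \<le> n" "int n \<le> H"
  shows "real (card {f \<in> box_polys k H. poly f (int n) = v}) \<le> (3 * real_of_int H / real n) ^ k"
proof (induction k arbitrary: v)
  case 0
  have "{f \<in> box_polys 0 H. poly f (int n) = v} \<subseteq> {[:v:]}"
    using assms by (auto simp: box_polys_0)
  hence "card {f \<in> box_polys 0 H. poly f (int n) = v} \<le> card {[:v:]}" by (intro card_mono) auto
  thus ?case by simp
next
  case (Suc k)
  have H: "H \<ge> 0" using assms by linarith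
  let ?M = "(3 * real_of_int H / real n) ^ k"
  have "real (card {f \<in> box_polys (Suc k) H. poly f (int n) = v})
      = (\<Sum>f\<in>box_polys (Suc k) H. of_bool (poly f (int n) = v))"
    using finite_box_polys[OF H] by (simp add: Int_def)
  also have "\<dots> = (\<Sum>g\<in>box_polys k H. \<Sum>c\<in>{-H..H}. of_bool (c + int n * poly g (int n) = v))"
    by (simp add: sum_box_polys_Suc[OF H])
  also have "\<dots> = (\<Sum>c\<in>{-H..H}. \<Sum>g\<in>box_polys k H. of_bool (c + int n * poly g (int n) = v))"
    by (rule sum.swap)
  also have "\<dots> \<le> (\<Sum>c\<in>{-H..H}. of_bool (int n dvd c + (- v)) * ?M)"
  proof (rule sum_mono)
    fix c
    show "(\<Sum>g\<in>box_polys k H. of_bool (c + int n * poly g (int n) = v)) \<le> of_bool (int n dvd c + (- v)) * ?M"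
    proof (cases "int n dvd c + (- v)")
      case True
      then obtain w where w: "c - v = int n * w" by (auto elim: dvdE)
      have "(c + int n * poly g (int n) = v) \<longleftrightarrow> poly g (int n) = - w" for g
      proof -
        have "c + int n * poly g (int n) = v \<longleftrightarrow> int n * (w + poly g (int n)) = 0"
          using w by (auto simp: algebra_simps)
        thus ?thesis using assms by (auto simp: eq_neg_iff_add_eq_0 add.commute)
      qed
      hence "(\<Sum>g\<in>box_polys k H. of_bool (c + int n * poly g (int n) = v))
          = real (card {g \<in> box_polys k H. poly g (int n) = - w})"
        using finite_box_polys[OF H] by (simp add: Int_def)
      thus ?thesis using True Suc.IH[of "- w"] by simp
    next
      case False
      hence "c + int n * poly g (int n) \<noteq> v" for g by auto
      thus ?thesis using False by simp
    qed
  qed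
  also have "\<dots> = real (card {c \<in> {-H..H}. int n dvd c + (- v)}) * ?M"
    by (simp add: Int_def sum_distrib_right[symmetric])
  also have "\<dots> \<le> (3 * real_of_int H / real n) * ?M"
  proof (rule mult_right_mono)
    \<comment> \<open>The rounding error 1 is absorbed because \<open>n\<close> is at most
      \<open>H\<close>, which turns the factor 2 into 3.\<close>
    have "1 \<le> real_of_int H / real n" using assms by (simp add: field_simps)
    moreover have "\<bar>real (card {c \<in> {-H..H}. int n dvd c + (- v)}) - 2 * real_of_int H / real n\<bar> \<le> 1"
      using card_residue_class_interval[of "int n" H "- v"] assms H unfolding of_int_of_nat_eq by simp
    moreover have "3 * real_of_int H / real n = 2 * real_of_int H / real n + real_of_int H / real n"
      by (simp add: add_divide_distrib[symmetric])
    ultimately show "real (card {c \<in> {-H..H}. int n dvd c + (- v)}) \<le> 3 * real_of_int H / real n"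
      by linarith
  qed (use H in simp)
  finally show ?case by simp
qed

lemma abs_poly_box_polys_le:
  fixes n :: nat
  assumes "1 \<le> n" "H \<ge> 0" "f \<in> box_polys k H"
  shows "\<bar>poly f (int n)\<bar> \<le> int (k + 1) * H * int n ^ k"
  using assms(3)
proof (induction k arbitrary: f)
  case 0
  thus ?case using assms by (auto simp: box_polys_0)
next
  case (Suc k)
  obtain c g where cg: "f = pCons c g" by (cases f)
  hence *: "\<bar>c\<bar> \<le> H" "g \<in> box_polys k H" using Suc.prems pCons_in_box_polys assms by blast+
  have "\<bar>poly f (int n)\<bar> \<le> \<bar>c\<bar> + int n * \<bar>poly g (int n)\<bar>"
    using abs_triangle_ineq[of c "int n * poly g (int n)"] cg by (simp add: abs_mult)
  also have "\<dots> \<le> H * int n ^ Suc k + int n * (int (k + 1) * H * int n ^ k)"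
  proof (intro add_mono mult_left_mono Suc.IH *)
    have "\<bar>c\<bar> \<le> H * 1" using * by simp
    also have "\<dots> \<le> H * int n ^ Suc k" using assms by (intro mult_left_mono one_le_power) auto
    finally show "\<bar>c\<bar> \<le> H * int n ^ Suc k" .
  qed simp
  also have "\<dots> = int (Suc k + 1) * H * int n ^ Suc k" by (simp add: algebra_simps)
  finally show ?case .
qed

lemma card_nonzero_multiples_le:
  fixes V q :: int
  assumes "V \<ge> 0" "q > 0"
  shows "real (card {v \<in> {-V..V} - {0}. q dvd v}) \<le> 2 * real_of_int V / real_of_int q"
proof -
  let ?m = "V div q"
  have m: "?m \<ge> 0" using assms by (simp add: pos_imp_zdiv_nonneg_iff)
  have "{v \<in> {-V..V} - {0}. q dvd v} \<subseteq> (\<lambda>t. q * t) ` ({-?m..?m} - {0})"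
  proof
    fix v assume v: "v \<in> {v \<in> {-V..V} - {0}. q dvd v}"
    then obtain t where t: "v = q * t" by (auto elim: dvdE)
    have "q * t \<le> V" "q * (- t) \<le> V" using v t by auto
    hence "(q * t) div q \<le> ?m" "(q * (- t)) div q \<le> ?m" using assms by (intro zdiv_mono1; simp)+
    moreover have "(q * t) div q = t" "(q * (- t)) div q = - t"
      using assms by (intro nonzero_mult_div_cancel_left; simp)+
    ultimately have "t \<le> ?m" "- t \<le> ?m" by simp_all
    thus "v \<in> (\<lambda>t. q * t) ` ({-?m..?m} - {0})" using t v by (intro image_eqI[of _ _ t]) auto
  qed
  hence "card {v \<in> {-V..V} - {0}. q dvd v} \<le> card ({-?m..?m} - {0})"
    by (intro surj_card_le) auto
  also have "\<dots> = nat (2 * ?m)" using m by (subst card_Diff_singleton) auto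
  finally have "real (card {v \<in> {-V..V} - {0}. q dvd v}) \<le> 2 * real_of_int ?m"
    using m by linarith
  also have "real_of_int ?m \<le> real_of_int V / real_of_int q"
    using floor_divide_of_int_eq[of V q, where ?'a = real] by linarith
  finally show ?thesis by simp
qed

lemma sum_inverse_squares_le:
  assumes "N \<ge> 1"
  shows "(\<Sum>d\<in>{N<..X}. 1 / (real d)\<^sup>2) \<le> 1 / real N"
proof (cases "X \<le> N")
  case False
  hence "N \<le> X" by simp
  \<comment> \<open>The subtracted \<open>1 / X\<close> makes the induction telescope.\<close>
  hence "(\<Sum>d\<in>{N<..X}. 1 / (real d)\<^sup>2) \<le> 1 / real N - 1 / real X"
  proof (induction X rule: dec_induct)
    case (step X)
    have "{N<..Suc X} = insert (Suc X) {N<..X}" using step by auto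
    hence "(\<Sum>d\<in>{N<..Suc X}. 1 / (real d)\<^sup>2) \<le> 1 / (real (Suc X))\<^sup>2 + (1 / real N - 1 / real X)"
      using step.IH by simp
    also have "1 / (real (Suc X))\<^sup>2 \<le> 1 / (real X * real (Suc X))"
      using step assms by (intro divide_left_mono) (auto simp: power2_eq_square)
    also have "\<dots> = 1 / real X - 1 / real (Suc X)"
      using step assms by (simp add: field_simps)
    finally show ?case by simp
  qed simp
  also have "\<dots> \<le> 1 / real N" by simp
  finally show ?thesis .
qed (use assms in simp)

section \<open>The error of the truncated squarefree indicator\<close>

text \<open>For nonzero \<open>m\<close> the full Moebius sum is exact and finite, so only the
  divisors \<open>d > N\<close> are lost. Zero is not squarefree while every square divides it, so
  there the truncated sum itself is bounded trivially by \<open>N\<close>.\<close>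

lemma squarefree_indicator_truncation:
  fixes m :: int and N :: nat
  assumes "N \<ge> 1"
  shows "\<bar>of_bool (squarefree m) - (\<Sum>d=1..N. real_of_int (moebius_mu d) * of_bool ((int d)\<^sup>2 dvd m))\<bar>
    \<le> (if m = 0 then real N else real (card {d. N < d \<and> (int d)\<^sup>2 dvd m}))"
proof (cases "m = 0")
  case True
  have "\<bar>\<Sum>d=1..N. real_of_int (moebius_mu d) * of_bool ((int d)\<^sup>2 dvd m)\<bar> \<le> (\<Sum>d=1..N. 1)"
    by (rule order.trans[OF sum_abs], rule sum_mono) (use moebius_mu_abs_le in \<open>simp add: abs_mult\<close>)
  thus ?thesis using True by simp
next
  case False
  let ?A = "{d. (int d)\<^sup>2 dvd m}" and ?B = "{d. N < d \<and> (int d)\<^sup>2 dvd m}"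
  have fin: "finite ?A"
  proof (rule finite_subset)
    show "?A \<subseteq> {..nat \<bar>m\<bar>}"
    proof safe
      fix d assume d: "(int d)\<^sup>2 dvd m"
      have "int d \<le> (int d)\<^sup>2" by (cases d) (auto simp: power2_eq_square)
      also have "\<dots> \<le> \<bar>m\<bar>" using d False by (metis dvd_imp_le_int abs_power2)
      finally show "d \<le> nat \<bar>m\<bar>" by linarith
    qed
  qed simp
  have 0: "0 \<notin> ?A" using False by auto
  have "of_bool (squarefree m) = real_of_int (\<Sum>d\<in>?A. moebius_mu d)"
    using sum_moebius_square_dvd[OF False] by simp
  also have "\<dots> = (\<Sum>d\<in>?A \<inter> {1..N}. real_of_int (moebius_mu d)) + (\<Sum>d\<in>?B. real_of_int (moebius_mu d))"
  proof -
    have "?A = (?A \<inter> {1..N}) \<union> ?B" using 0 by (auto intro: Suc_leI gr0I)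
    hence "(\<Sum>d\<in>?A. real_of_int (moebius_mu d)) = (\<Sum>d\<in>(?A \<inter> {1..N}) \<union> ?B. real_of_int (moebius_mu d))"
      by simp
    also have "\<dots> = (\<Sum>d\<in>?A \<inter> {1..N}. real_of_int (moebius_mu d)) + (\<Sum>d\<in>?B. real_of_int (moebius_mu d))"
      by (rule sum.union_disjoint) (use fin in auto)
    finally show ?thesis by simp
  qed
  also have "(\<Sum>d\<in>?A \<inter> {1..N}. real_of_int (moebius_mu d))
      = (\<Sum>d=1..N. real_of_int (moebius_mu d) * of_bool ((int d)\<^sup>2 dvd m))"
    by (rule sum.mono_neutral_cong_left) auto
  finally have "\<bar>of_bool (squarefree m) - (\<Sum>d=1..N. real_of_int (moebius_mu d) * of_bool ((int d)\<^sup>2 dvd m))\<bar>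
      = \<bar>\<Sum>d\<in>?B. real_of_int (moebius_mu d)\<bar>" by simp
  also have "\<dots> \<le> (\<Sum>d\<in>?B. 1)"
    by (rule order.trans[OF sum_abs], rule sum_mono) (rule moebius_mu_abs_le)
  finally show ?thesis using False by simp
qed

lemma sum_box_polys_truncation_error:
  fixes n N :: nat and H :: int
  assumes "1 \<le> n" "n \<le> N" "int N \<le> H"
  shows "(\<Sum>f\<in>box_polys k H. \<bar>of_bool (squarefree (poly f (int n)))
      - (\<Sum>d=1..N. real_of_int (moebius_mu d) * of_bool ((int d)\<^sup>2 dvd poly f (int n)))\<bar>)
    \<le> 3 ^ k * (real N * real_of_int H ^ k + 2 * real (k + 1) * real_of_int H ^ (k + 1) / real N)"
proof -
  have H: "H \<ge> 1" using assms by linarith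
  define V where "V = int (k + 1) * H * int n ^ k"
  have V0: "V \<ge> 0" using H by (simp add: V_def)
  define \<psi> where "\<psi> = (\<lambda>m. if m = 0 then real N else real (card {d. N < d \<and> (int d)\<^sup>2 dvd m}))"
  define R where "R = (3 * real_of_int H / real n) ^ k"
  have R0: "R \<ge> 0" using H by (simp add: R_def)
  have \<psi>0: "\<psi> m \<ge> 0" for m by (simp add: \<psi>_def)
  have "(\<Sum>f\<in>box_polys k H. \<bar>of_bool (squarefree (poly f (int n)))
      - (\<Sum>d=1..N. real_of_int (moebius_mu d) * of_bool ((int d)\<^sup>2 dvd poly f (int n)))\<bar>)
    \<le> (\<Sum>f\<in>box_polys k H. \<psi> (poly f (int n)))"
    unfolding \<psi>_def using assms by (intro sum_mono squarefree_indicator_truncation) auto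
  \<comment> \<open>The polynomials are grouped by their value \<open>v\<close> at \<open>n\<close>,
    and \<open>R\<close> bounds the size of each group. The value 0 costs \<open>N\<close>; for
    nonzero values the sum over \<open>v\<close> and \<open>d\<close> is interchanged.\<close>
  also have "\<dots> = (\<Sum>v\<in>{-V..V}. \<Sum>f | f \<in> box_polys k H \<and> poly f (int n) = v. \<psi> (poly f (int n)))"
  proof (rule sum.group[symmetric])
    show "(\<lambda>f. poly f (int n)) ` box_polys k H \<subseteq> {-V..V}"
      using abs_poly_box_polys_le[OF assms(1), of H _ k] H by (force simp: V_def abs_le_iff)
  qed (use finite_box_polys H in auto)
  also have "\<dots> = (\<Sum>v\<in>{-V..V}. real (card {f \<in> box_polys k H. poly f (int n) = v}) * \<psi> v)"
    by (intro sum.cong) auto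
  also have "\<dots> \<le> (\<Sum>v\<in>{-V..V}. R * \<psi> v)"
    unfolding R_def using assms by (intro sum_mono mult_right_mono card_box_polys_value_le \<psi>0) auto
  also have "\<dots> = R * (\<psi> 0 + (\<Sum>v\<in>{-V..V} - {0}. \<psi> v))"
    using V0 by (simp add: sum_distrib_left[symmetric] sum.remove[of "{-V..V}" 0])
  also have "(\<Sum>v\<in>{-V..V} - {0}. \<psi> v) \<le> 2 * real_of_int V / real N"
  proof -
    have "(\<Sum>v\<in>{-V..V} - {0}. \<psi> v)
        = (\<Sum>v\<in>{-V..V} - {0}. \<Sum>d\<in>{N<..nat V}. of_bool ((int d)\<^sup>2 dvd v))"
    proof (rule sum.cong)
      fix v assume v: "v \<in> {-V..V} - {0}"
      have "d \<le> nat V" if "(int d)\<^sup>2 dvd v" for d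
      proof -
        have "int d \<le> (int d)\<^sup>2" by (cases d) (auto simp: power2_eq_square)
        also have "\<dots> \<le> \<bar>v\<bar>" using that v by (metis DiffD2 singletonI dvd_imp_le_int abs_power2)
        finally show ?thesis using v by auto
      qed
      hence "{d. N < d \<and> (int d)\<^sup>2 dvd v} = {d \<in> {N<..nat V}. (int d)\<^sup>2 dvd v}" by auto
      thus "\<psi> v = (\<Sum>d\<in>{N<..nat V}. of_bool ((int d)\<^sup>2 dvd v))"
        using v by (simp add: \<psi>_def Int_def)
    qed simp
    also have "\<dots> = (\<Sum>d\<in>{N<..nat V}. \<Sum>v\<in>{-V..V} - {0}. of_bool ((int d)\<^sup>2 dvd v))"
      by (rule sum.swap)
    also have "\<dots> = (\<Sum>d\<in>{N<..nat V}. real (card {v \<in> {-V..V} - {0}. (int d)\<^sup>2 dvd v}))"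
      by (intro sum.cong) (auto simp: Int_def)
    also have "\<dots> \<le> (\<Sum>d\<in>{N<..nat V}. 2 * real_of_int V / real_of_int ((int d)\<^sup>2))"
      using V0 by (intro sum_mono card_nonzero_multiples_le) auto
    also have "\<dots> = 2 * real_of_int V * (\<Sum>d\<in>{N<..nat V}. 1 / (real d)\<^sup>2)"
      by (simp add: sum_distrib_left)
    also have "\<dots> \<le> 2 * real_of_int V * (1 / real N)"
      using assms V0 by (intro mult_left_mono sum_inverse_squares_le) auto
    finally show ?thesis by simp
  qed
  finally have *: "(\<Sum>f\<in>box_polys k H. \<bar>of_bool (squarefree (poly f (int n)))
      - (\<Sum>d=1..N. real_of_int (moebius_mu d) * of_bool ((int d)\<^sup>2 dvd poly f (int n)))\<bar>)
     \<le> R * (real N + 2 * real_of_int V / real N)"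
    using R0 by (simp add: \<psi>_def mult_left_mono)
  have RN: "R \<le> 3 ^ k * real_of_int H ^ k"
    unfolding R_def power_mult_distrib[symmetric] using assms H
    by (intro power_mono) (auto simp: field_simps)
  \<comment> \<open>The power \<open>n ^ k\<close> in the range of values cancels against the
    \<open>n ^ k\<close> in the denominator of \<open>R\<close>, so the estimate is uniform in
    \<open>n\<close>.\<close>
  have RV: "R * real_of_int V = 3 ^ k * (real (k + 1) * real_of_int H ^ (k + 1))"
    using assms by (simp add: R_def V_def power_divide power_mult_distrib)
  have "R * (real N + 2 * real_of_int V / real N) = R * real N + 2 * (R * real_of_int V) / real N"
    by (simp add: algebra_simps)
  also have "\<dots> \<le> 3 ^ k * real_of_int H ^ k * real N + 2 * (3 ^ k * (real (k + 1) * real_of_int H ^ (k + 1))) / real N"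
    unfolding RV using RN by (intro add_mono mult_right_mono) auto
  also have "\<dots> = 3 ^ k * (real N * real_of_int H ^ k + 2 * real (k + 1) * real_of_int H ^ (k + 1) / real N)"
    by (simp add: algebra_simps)
  finally show ?thesis using * by linarith
qed

section \<open>Primitive polynomials divisible at a point\<close>

lemma content_pCons_int: "content (pCons c g) = gcd c (content g)" for c :: int
proof (cases "g = 0 \<and> c = 0")
  case False
  thus ?thesis by (auto simp: content_def cCons_def)
qed auto

lemma content_le_box_polys:
  assumes "g \<in> box_polys k H" "g \<noteq> 0"
  shows "content g > 0" "content g \<le> H"
proof -
  have "content g \<ge> 0" by (metis normalize_content abs_ge_zero normalize_int_def)
  thus pos: "content g > 0" using assms by (simp add: order_less_le)
  have "content g dvd lead_coeff g" by (rule content_dvd_coeff)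
  hence "content g \<le> \<bar>lead_coeff g\<bar>" using assms(2) pos by (metis dvd_imp_le_int abs_of_pos leading_coeff_0_iff)
  moreover have "\<bar>lead_coeff g\<bar> \<le> H" using assms(1) by (simp add: box_polys_def)
  ultimately show "content g \<le> H" by linarith
qed

text \<open>For a divisor \<open>e\<close> of the content of \<open>g\<close>, the condition \<open>e dvd c\<close> is equivalent to
  \<open>e dvd c + n * poly g n\<close>, so the main term below does not depend on \<open>n\<close>.\<close>

lemma card_primitive_constant_terms:
  fixes g :: "int poly" and H :: int and d :: nat
  assumes g: "g \<noteq> 0" and d: "d \<ge> 1" and H: "H \<ge> 0"
  shows "\<exists>M. \<forall>n. \<bar>real (card {c \<in> {-H..H}. content (pCons c g) = 1 \<and> (int d)\<^sup>2 dvd poly (pCons c g) n}) - M\<bar>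
      \<le> 2 ^ card (prime_factors (nat (content g)))"
proof -
  define \<gamma> where "\<gamma> = nat (content g)"
  have "content g \<ge> 0" by (metis normalize_content abs_ge_zero normalize_int_def)
  hence \<gamma>: "int \<gamma> = content g" "\<gamma> > 0" using g by (auto simp: \<gamma>_def order_less_le)
  have cdvd: "int \<gamma> dvd poly g n" for n
  proof -
    have "[:content g:] dvd g" by (simp add: const_poly_dvd_iff_dvd_content)
    then obtain h where "g = [:content g:] * h" by (elim dvdE)
    hence "poly g n = content g * poly h n" by (metis poly_mult poly_pCons poly_0 mult_zero_right add_0_right)
    thus ?thesis by (simp add: \<gamma>)
  qed
  let ?S = "\<lambda>n. {c \<in> {-H..H}. content (pCons c g) = 1 \<and> (int d)\<^sup>2 dvd poly (pCons c g) n}"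
  show ?thesis
  proof (cases "coprime \<gamma> d")
    \<comment> \<open>A prime dividing both \<open>d\<close> and the content of \<open>g\<close>
      would have to divide \<open>c\<close> as well, contradicting content 1; the set of constant
      terms is empty.\<close>
    case False
    hence "gcd \<gamma> d \<noteq> 1" by (simp add: coprime_iff_gcd_eq_1)
    then obtain p where "prime p" "p dvd gcd \<gamma> d" using prime_factor_nat by blast
    hence p: "prime p" "p dvd \<gamma>" "p dvd d" by simp_all
    have "?S n = {}" for n
    proof -
      have "False" if c: "content (pCons c g) = 1" "(int d)\<^sup>2 dvd poly (pCons c g) n" for c
      proof -
        have "int p dvd (int d)\<^sup>2" using p by (simp add: power2_eq_square)
        hence "int p dvd c + n * poly g n" using c(2) by (auto dest: dvd_trans)
        moreover have "int p dvd n * poly g n"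
          using p cdvd[of n] by (meson dvd_mult dvd_trans int_dvd_int_iff)
        ultimately have "int p dvd c" by (simp add: dvd_add_left_iff)
        moreover have "int p dvd content g" using p by (simp flip: \<gamma>(1))
        ultimately have "int p dvd 1" using c(1) by (metis content_pCons_int gcd_greatest)
        thus False using p by auto
      qed
      thus ?thesis by blast
    qed
    thus ?thesis by (intro exI[of _ 0]) (simp only: card.empty, simp)
  next
    case True
    let ?E = "{e. squarefree e \<and> e dvd \<gamma>}"
    have finE: "finite ?E" using \<gamma> by (intro finite_subset[OF _ finite_divisors_nat[of \<gamma>]]) auto
    define M where "M = (\<Sum>e\<in>?E. real_of_int (moebius_mu e) * (2 * real_of_int H / real_of_int (int e * (int d)\<^sup>2)))"
    have "\<bar>real (card (?S n)) - M\<bar> \<le> 2 ^ card (prime_factors \<gamma>)" for n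
    proof -
      let ?T = "\<lambda>e. {c \<in> {-H..H}. int e * (int d)\<^sup>2 dvd c + n * poly g n}"
      have ind: "of_bool (content (pCons c g) = 1 \<and> (int d)\<^sup>2 dvd poly (pCons c g) n)
          = (\<Sum>e\<in>?E. real_of_int (moebius_mu e) * of_bool (int e * (int d)\<^sup>2 dvd c + n * poly g n))" for c
      proof -
        have iff: "int e * (int d)\<^sup>2 dvd c + n * poly g n \<longleftrightarrow> int e dvd c \<and> (int d)\<^sup>2 dvd poly (pCons c g) n"
          if e: "e \<in> ?E" for e
        proof -
          have "int e dvd int \<gamma>" using e by simp
          hence "int e dvd n * poly g n" by (rule dvd_mult[OF dvd_trans[OF _ cdvd]])
          hence "int e dvd c + n * poly g n \<longleftrightarrow> int e dvd c" by (simp add: dvd_add_left_iff)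
          moreover have "coprime (int e) ((int d)\<^sup>2)"
            using e True by (auto intro: coprime_divisors[of _ \<gamma> _ d])
          ultimately show ?thesis by (auto intro: divides_mult dest: dvd_mult_left dvd_mult_right)
        qed
        define h where "h = nat (gcd c (int \<gamma>))"
        have h0: "h > 0" using \<gamma>(2) by (simp add: h_def)
        have h: "int h = content (pCons c g)" by (simp add: h_def content_pCons_int \<gamma>)
        \<comment> \<open>The primitivity condition is itself detected by a Moebius sum, over the
          common divisors of \<open>c\<close> and \<open>\<gamma>\<close>; the index set
          \<open>?E\<close> no longer depends on \<open>c\<close>.\<close>
        have "(\<Sum>e | e dvd h. moebius_mu e) = (\<Sum>e\<in>?E. moebius_mu e * of_bool (int e dvd c))"
        proof (rule sum.mono_neutral_cong)
          show "finite ?E" by fact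
          show "moebius_mu e * of_bool (int e dvd c) = 0" if "e \<in> ?E - {e. e dvd h}" for e
          proof -
            have "\<not> int e dvd c"
              using that by (auto simp: h_def simp flip: int_dvd_int_iff)
            thus ?thesis by simp
          qed
          show "moebius_mu e = 0" if "e \<in> {e. e dvd h} - ?E" for e
          proof -
            have "int e dvd int \<gamma>" using that by (auto simp: h_def simp flip: int_dvd_int_iff)
            thus ?thesis using that by (auto simp: moebius_mu_def)
          qed
          show "moebius_mu e = moebius_mu e * of_bool (int e dvd c)" if "e \<in> {e. e dvd h} \<inter> ?E" for e
          proof -
            have "int e dvd int h" using that by auto
            thus ?thesis by (simp add: h_def)
          qed
        qed (use h0 in simp)
        hence sum_h: "(\<Sum>e\<in>?E. moebius_mu e * of_bool (int e dvd c)) = (if h = 1 then 1 else 0)"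
          using sum_moebius_dvd[OF h0] by (rule trans[OF sym])
        have h1: "content (pCons c g) = 1 \<longleftrightarrow> h = 1" unfolding h[symmetric] by simp
        have "(\<Sum>e\<in>?E. real_of_int (moebius_mu e) * of_bool (int e dvd c))
            = real_of_int (\<Sum>e\<in>?E. moebius_mu e * of_bool (int e dvd c))" by simp
        hence *: "(\<Sum>e\<in>?E. real_of_int (moebius_mu e) * of_bool (int e dvd c)) = of_bool (content (pCons c g) = 1)"
          unfolding sum_h h1 by simp
        have "(\<Sum>e\<in>?E. real_of_int (moebius_mu e) * of_bool (int e * (int d)\<^sup>2 dvd c + n * poly g n))
            = (\<Sum>e\<in>?E. real_of_int (moebius_mu e) * of_bool (int e dvd c)) * of_bool ((int d)\<^sup>2 dvd poly (pCons c g) n)"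
          unfolding sum_distrib_right by (intro sum.cong) (simp_all only: iff of_bool_conj mult.assoc)
        thus ?thesis unfolding * by (simp only: of_bool_conj)
      qed
      have "real (card (?S n)) = (\<Sum>c\<in>{-H..H}. of_bool (content (pCons c g) = 1 \<and> (int d)\<^sup>2 dvd poly (pCons c g) n))"
        by (simp add: Int_def)
      also have "\<dots> = (\<Sum>c\<in>{-H..H}. \<Sum>e\<in>?E. real_of_int (moebius_mu e) * of_bool (int e * (int d)\<^sup>2 dvd c + n * poly g n))"
        unfolding ind ..
      also have "\<dots> = (\<Sum>e\<in>?E. \<Sum>c\<in>{-H..H}. real_of_int (moebius_mu e) * of_bool (int e * (int d)\<^sup>2 dvd c + n * poly g n))"
        by (rule sum.swap)
      also have "\<dots> = (\<Sum>e\<in>?E. real_of_int (moebius_mu e) * real (card (?T e)))"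
        by (intro sum.cong refl) (simp add: sum_distrib_left[symmetric] Int_def)
      finally have "\<bar>real (card (?S n)) - M\<bar>
          = \<bar>\<Sum>e\<in>?E. real_of_int (moebius_mu e) * (real (card (?T e)) - 2 * real_of_int H / real_of_int (int e * (int d)\<^sup>2))\<bar>"
        by (simp add: M_def sum_subtractf right_diff_distrib)
      also have "\<dots> \<le> (\<Sum>e\<in>?E. 1 * 1)"
      proof (rule order.trans[OF sum_abs], rule sum_mono)
        fix e assume e: "e \<in> ?E"
        hence "e > 0" using \<gamma> by (auto intro!: Nat.gr0I)
        hence "\<bar>real (card (?T e)) - 2 * real_of_int H / real_of_int (int e * (int d)\<^sup>2)\<bar> \<le> 1"
          using d H by (intro card_residue_class_interval) auto
        thus "\<bar>real_of_int (moebius_mu e) * (real (card (?T e)) - 2 * real_of_int H / real_of_int (int e * (int d)\<^sup>2))\<bar> \<le> 1 * 1"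
          unfolding abs_mult by (intro mult_mono moebius_mu_abs_le) auto
      qed
      also have "\<dots> \<le> 2 ^ card (prime_factors \<gamma>)"
        using card_squarefree_divisors[OF \<gamma>(2)] by (simp flip: of_nat_power_le_of_nat_cancel_iff) 
      finally show ?thesis .
    qed
    thus ?thesis unfolding \<gamma>_def[symmetric] by blast
  qed
qed

text \<open>The main term is the same for \<open>n\<close> and \<open>n'\<close>, so only the two
  errors remain, for each choice of the nonconstant coefficients. The exponent 1/3 is small enough
  that a later factor \<open>N\<^sup>2\<close> still fits below \<open>H\<close> when
  \<open>N ^ 3\<close> is at most \<open>H\<close>.\<close>

lemma card_primitive_divisible_diff:
  "\<exists>C>0. \<forall>k H (d::nat) n n'. H \<ge> 1 \<longrightarrow> d \<ge> 1 \<longrightarrow>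
     \<bar>real (card {f \<in> primitive_polys (Suc k) H. (int d)\<^sup>2 dvd poly f n})
      - real (card {f \<in> primitive_polys (Suc k) H. (int d)\<^sup>2 dvd poly f n'})\<bar>
     \<le> C * real_of_int H powr (1/3) * (2 * real_of_int H + 1) ^ Suc k"
proof -
  obtain C0 where C0: "C0 \<ge> 1" "\<And>m::nat. m > 0 \<Longrightarrow> 2 ^ card (prime_factors m) \<le> C0 * real m powr (1/3)"
    using power_card_prime_factors_bound[of 2 "1/3"] by auto
  define C where "C = 2 * C0"
  have "\<bar>real (card {f \<in> primitive_polys (Suc k) H. (int d)\<^sup>2 dvd poly f n})
      - real (card {f \<in> primitive_polys (Suc k) H. (int d)\<^sup>2 dvd poly f n'})\<bar>
     \<le> C * real_of_int H powr (1/3) * (2 * real_of_int H + 1) ^ Suc k"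
    if H: "H \<ge> 1" and d: "d \<ge> 1" for k H n n' and d :: nat
  proof -
    let ?S = "\<lambda>g n. {c \<in> {-H..H}. content (pCons c g) = 1 \<and> (int d)\<^sup>2 dvd poly (pCons c g) n}"
    have eq: "real (card {f \<in> primitive_polys (Suc k) H. (int d)\<^sup>2 dvd poly f n})
        = (\<Sum>g\<in>box_polys k H. real (card (?S g n)))" for n
    proof -
      have "real (card {f \<in> primitive_polys (Suc k) H. (int d)\<^sup>2 dvd poly f n})
          = (\<Sum>f\<in>box_polys (Suc k) H. of_bool (content f = 1 \<and> (int d)\<^sup>2 dvd poly f n))"
        using H finite_box_polys[of H "Suc k"] by (simp add: primitive_polys_eq Int_def conj_assoc)
      also have "\<dots> = (\<Sum>g\<in>box_polys k H. real (card (?S g n)))"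
        using H by (subst sum_box_polys_Suc) (auto simp: Int_def simp del: poly_pCons)
      finally show ?thesis .
    qed
    have bd: "\<bar>real (card (?S g n)) - real (card (?S g n'))\<bar> \<le> C * real_of_int H powr (1/3)"
      if g: "g \<in> box_polys k H" for g
    proof (cases "g = 0")
      \<comment> \<open>For \<open>g = 0\<close> the value of the polynomial does not depend on the
        point, so the two counts coincide.\<close>
      case True
      thus ?thesis using C0 by (simp add: C_def)
    next
      case False
      obtain M where M: "\<And>n. \<bar>real (card (?S g n)) - M\<bar> \<le> 2 ^ card (prime_factors (nat (content g)))"
        using card_primitive_constant_terms[OF False d, of H] H by auto
      note cont = content_le_box_polys[OF g False]
      have "\<bar>real (card (?S g n)) - real (card (?S g n'))\<bar> \<le> 2 * 2 ^ card (prime_factors (nat (content g)))"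
        using M[of n] M[of n'] by linarith
      also have "2 ^ card (prime_factors (nat (content g))) \<le> C0 * real (nat (content g)) powr (1/3)"
        using cont by (intro C0) auto
      also have "\<dots> \<le> C0 * real_of_int H powr (1/3)"
        using cont C0 by (intro mult_left_mono powr_mono2) auto
      finally show ?thesis by (simp add: C_def)
    qed
    have "\<bar>real (card {f \<in> primitive_polys (Suc k) H. (int d)\<^sup>2 dvd poly f n})
      - real (card {f \<in> primitive_polys (Suc k) H. (int d)\<^sup>2 dvd poly f n'})\<bar>
      = \<bar>\<Sum>g\<in>box_polys k H. real (card (?S g n)) - real (card (?S g n'))\<bar>"
      unfolding eq by (simp only: sum_subtractf)
    also have "\<dots> \<le> (\<Sum>g\<in>box_polys k H. C * real_of_int H powr (1/3))"
      by (rule order.trans[OF sum_abs], rule sum_mono, rule bd)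
    also have "\<dots> = C * real_of_int H powr (1/3) * (2 * real_of_int H + 1) ^ Suc k"
      using H by (simp add: card_box_polys)
    finally show ?thesis .
  qed
  moreover have "C > 0" using C0 by (simp add: C_def)
  ultimately show ?thesis by blast
qed

text \<open>The root density modulo the square of \<open>d\<close> is the mean of the divisibility
  indicator over a full residue system. After interchanging sums, the difference is an average of
  \<open>A n - A n'\<close>, each at most \<open>C\<close> in absolute value, for each of the
  \<open>N\<close> points.\<close>

lemma sum_primitive_level_error:
  fixes C :: real
  assumes C: "\<And>n n'. \<bar>real (card {f \<in> F. (int d)\<^sup>2 dvd poly f n}) - real (card {f \<in> F. (int d)\<^sup>2 dvd poly f n'})\<bar> \<le> C"
    and d: "d \<ge> 1" and F: "finite F"
  shows "\<bar>\<Sum>f\<in>F. real (card {n \<in> {1..N}. (int d)\<^sup>2 dvd poly f (int n)}) - real N * (real (root_count f (d\<^sup>2)) / (real d)\<^sup>2)\<bar>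
    \<le> real N * C"
proof -
  define A where "A = (\<lambda>n. real (card {f \<in> F. (int d)\<^sup>2 dvd poly f n}))"
  have "(\<Sum>f\<in>F. real (card {n \<in> {1..N}. (int d)\<^sup>2 dvd poly f (int n)}))
      = (\<Sum>f\<in>F. \<Sum>n\<in>{1..N}. of_bool ((int d)\<^sup>2 dvd poly f (int n)))"
    by (simp add: Int_def)
  also have "\<dots> = (\<Sum>n\<in>{1..N}. \<Sum>f\<in>F. of_bool ((int d)\<^sup>2 dvd poly f (int n)))" by (rule sum.swap)
  also have "\<dots> = (\<Sum>n\<in>{1..N}. A (int n))" using F by (simp add: A_def Int_def)
  finally have 1: "(\<Sum>f\<in>F. real (card {n \<in> {1..N}. (int d)\<^sup>2 dvd poly f (int n)})) = (\<Sum>n\<in>{1..N}. A (int n))" .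
  have "(\<Sum>f\<in>F. real (root_count f (d\<^sup>2))) = (\<Sum>f\<in>F. \<Sum>n\<in>{0..<int (d\<^sup>2)}. of_bool ((int d)\<^sup>2 dvd poly f n))"
    by (simp add: Int_def root_count_def cong_0_iff conj_assoc)
  also have "\<dots> = (\<Sum>n\<in>{0..<int (d\<^sup>2)}. \<Sum>f\<in>F. of_bool ((int d)\<^sup>2 dvd poly f n))" by (rule sum.swap)
  also have "\<dots> = (\<Sum>n\<in>{0..<int (d\<^sup>2)}. A n)" using F by (simp add: A_def Int_def)
  finally have 2: "(\<Sum>f\<in>F. real (root_count f (d\<^sup>2))) = (\<Sum>n\<in>{0..<int (d\<^sup>2)}. A n)" .
  have d0: "(real d)\<^sup>2 > 0" using d by simp
  have "(\<Sum>f\<in>F. real (card {n \<in> {1..N}. (int d)\<^sup>2 dvd poly f (int n)}) - real N * (real (root_count f (d\<^sup>2)) / (real d)\<^sup>2))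
     = (\<Sum>n\<in>{1..N}. A (int n)) - real N * ((\<Sum>n\<in>{0..<int (d\<^sup>2)}. A n) / (real d)\<^sup>2)"
    unfolding sum_subtractf 1 sum_distrib_left[symmetric] sum_divide_distrib[symmetric] 2 ..
  also have "\<dots> = (\<Sum>n\<in>{1..N}. \<Sum>n'\<in>{0..<int (d\<^sup>2)}. (A (int n) - A n') / (real d)\<^sup>2)"
    using d0 by (simp add: sum_divide_distrib[symmetric] sum_subtractf diff_divide_distrib)
  finally have eq: "(\<Sum>f\<in>F. real (card {n \<in> {1..N}. (int d)\<^sup>2 dvd poly f (int n)}) - real N * (real (root_count f (d\<^sup>2)) / (real d)\<^sup>2))
     = (\<Sum>n\<in>{1..N}. \<Sum>n'\<in>{0..<int (d\<^sup>2)}. (A (int n) - A n') / (real d)\<^sup>2)" .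
  have "\<bar>\<Sum>n\<in>{1..N}. \<Sum>n'\<in>{0..<int (d\<^sup>2)}. (A (int n) - A n') / (real d)\<^sup>2\<bar>
     \<le> (\<Sum>n\<in>{1..N}. \<Sum>n'\<in>{0..<int (d\<^sup>2)}. C / (real d)\<^sup>2)"
  proof (intro order.trans[OF sum_abs] sum_mono)
    fix n n'
    have "\<bar>A (int n) - A n'\<bar> \<le> C" unfolding A_def by (rule C)
    thus "\<bar>(A (int n) - A n') / (real d)\<^sup>2\<bar> \<le> C / (real d)\<^sup>2"
      unfolding abs_divide using d0 by (simp add: divide_right_mono)
  qed
  also have "\<dots> = real N * C" using d0 by simp
  finally show ?thesis unfolding eq .
qed

section \<open>A lower bound for the number of primitive polynomials\<close>

text \<open>Union bound: a pair that is not coprime has a common divisor \<open>m\<close> of size at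
  least 2, and at most \<open>(H / m)\<^sup>2\<close> pairs share a given \<open>m\<close>.\<close>

lemma card_coprime_pairs_ge:
  fixes H :: int
  assumes "H \<ge> 1"
  shows "real (card {(x, y) \<in> {1..H} \<times> {1..H}. coprime x y}) \<ge> (real_of_int H)\<^sup>2 / 4"
proof -
  let ?P = "{1..H} \<times> {1..H}" and ?G = "{(x, y) \<in> {1..H} \<times> {1..H}. coprime x y}"
  let ?D = "\<lambda>m::nat. {(x, y) \<in> {1..H} \<times> {1..H}. int m dvd x \<and> int m dvd y}"
  have sub: "?P - ?G \<subseteq> (\<Union>m\<in>{2..nat H}. ?D m)"
  proof
    fix z assume "z \<in> ?P - ?G"
    then obtain x y where z: "z = (x, y)" "x \<in> {1..H}" "y \<in> {1..H}" "\<not> coprime x y"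
      by (cases z) auto
    define m where "m = nat (gcd x y)"
    have m: "int m = gcd x y" by (simp add: m_def)
    have "gcd x y \<noteq> 1" using z(4) by (simp add: coprime_iff_gcd_eq_1)
    moreover have "gcd x y > 0" "gcd x y \<le> x" using z(2) by (auto intro: zdvd_imp_le)
    ultimately have "gcd x y \<ge> 2" "gcd x y \<le> x" by linarith+
    hence "2 \<le> int m" "int m \<le> H" using m z(2) by auto
    hence "m \<in> {2..nat H}" by auto
    moreover have "z \<in> ?D m" using z m by simp
    ultimately show "z \<in> (\<Union>m\<in>{2..nat H}. ?D m)" by blast
  qed
  have D: "real (card (?D m)) \<le> (real_of_int H)\<^sup>2 * (1 / (real m)\<^sup>2)" if "m \<ge> 2" for m
  proof -
    let ?M = "{x \<in> {1..H}. int m dvd x}"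
    have "?M \<subseteq> (\<lambda>t. int m * t) ` {1..H div int m}"
    proof
      fix x assume x: "x \<in> ?M"
      then obtain t where t: "x = int m * t" by (auto elim: dvdE)
      have mt: "0 < int m * t" "int m * t \<le> H" using x unfolding t by auto
      have m0: "int m > 0" using that by simp
      have "t \<ge> 1" using mt(1) m0 by (simp add: zero_less_mult_iff)
      moreover have "(int m * t) div int m \<le> H div int m" using mt(2) m0 by (rule zdiv_mono1)
      ultimately have "t \<in> {1..H div int m}" using m0 by simp
      thus "x \<in> (\<lambda>t. int m * t) ` {1..H div int m}" using t by blast
    qed
    hence "card ?M \<le> card {1..H div int m}" by (intro surj_card_le) auto
    hence "card ?M \<le> nat (H div int m)" by simp
    moreover have "H div int m \<ge> 0" using assms that by (simp add: pos_imp_zdiv_nonneg_iff)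
    ultimately have "real (card ?M) \<le> real_of_int (H div int m)" by linarith
    also have "\<dots> \<le> real_of_int H / real m"
      using floor_divide_of_int_eq[of H "int m", where ?'a = real] by (simp, linarith)
    finally have M: "real (card ?M) \<le> real_of_int H / real m" .
    have "?D m = ?M \<times> ?M" by auto
    hence "real (card (?D m)) = (real (card ?M))\<^sup>2" by (simp add: card_cartesian_product power2_eq_square)
    also have "\<dots> \<le> (real_of_int H / real m)\<^sup>2" using M by (intro power_mono) auto
    finally show ?thesis by (simp add: power_divide)
  qed
  have finP: "finite ?P" by simp
  have "finite (\<Union>m\<in>{2..nat H}. ?D m)" by (rule finite_subset[OF _ finP]) auto
  from card_mono[OF this sub]
  have "real (card (?P - ?G)) \<le> real (card (\<Union>m\<in>{2..nat H}. ?D m))" by (rule of_nat_mono)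
  also have "\<dots> \<le> real (\<Sum>m\<in>{2..nat H}. card (?D m))" by (intro of_nat_mono card_UN_le) simp
  also have "\<dots> \<le> (\<Sum>m\<in>{2..nat H}. (real_of_int H)\<^sup>2 * (1 / (real m)\<^sup>2))"
    unfolding of_nat_sum by (intro sum_mono D) auto
  also have "\<dots> = (real_of_int H)\<^sup>2 * (\<Sum>m\<in>{2..nat H}. 1 / (real m)\<^sup>2)" by (simp add: sum_distrib_left)
  \<comment> \<open>Splitting off \<open>m = 2\<close> keeps the total at 3/4; a tail bound starting
    from 1 would only give 1.\<close>
  also have "\<dots> \<le> (real_of_int H)\<^sup>2 * (1/4 + 1/2)"
  proof (rule mult_left_mono)
    have "(\<Sum>m\<in>{2..nat H}. 1 / (real m)\<^sup>2) \<le> (\<Sum>m\<in>insert 2 {2<..nat H}. 1 / (real m)\<^sup>2)"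
      by (rule sum_mono2) auto
    also have "\<dots> = 1/4 + (\<Sum>m\<in>{2<..nat H}. 1 / (real m)\<^sup>2)" by simp
    finally show "(\<Sum>m\<in>{2..nat H}. 1 / (real m)\<^sup>2) \<le> 1/4 + 1/2"
      using sum_inverse_squares_le[of 2 "nat H"] by simp
  qed simp
  finally have bad: "real (card (?P - ?G)) \<le> (real_of_int H)\<^sup>2 * (3/4)" by simp
  have sG: "?G \<subseteq> ?P" by auto
  have "card (?P - ?G) = card ?P - card ?G"
    by (rule card_Diff_subset[OF finite_subset[OF sG finP] sG])
  moreover have "card ?G \<le> card ?P" by (rule card_mono[OF finP sG])
  moreover have "real (card ?P) = (real_of_int H)\<^sup>2"
    using assms by (simp add: card_cartesian_product power2_eq_square)
  ultimately show ?thesis using bad by linarith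
qed

text \<open>Two coprime lowest coefficients already force content 1, so all others can be chosen
  freely. This matches the order \<open>H ^ (k + 1)\<close> of the whole box.\<close>

lemma card_primitive_polys_ge:
  assumes "H \<ge> 1" "k \<ge> 2"
  shows "real (card (primitive_polys k H)) \<ge> real_of_int H ^ (k + 1) / 4"
proof -
  obtain j where j: "k = Suc (Suc j)" using assms(2) by (metis add_2_eq_Suc le_Suc_ex)
  have H: "H \<ge> 0" using assms by simp
  let ?G = "{(x, y) \<in> {1..H} \<times> {1..H}. coprime x y}"
  have "real_of_int H ^ (k + 1) / 4 = real_of_int H ^ Suc j * ((real_of_int H)\<^sup>2 / 4)"
    by (simp add: j power2_eq_square)
  also have "\<dots> \<le> (2 * real_of_int H + 1) ^ Suc j * real (card ?G)"
    using assms card_coprime_pairs_ge[OF assms(1)] by (intro mult_mono power_mono) auto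
  also have "\<dots> = real (card (box_polys j H \<times> ?G))"
    using H by (simp add: card_cartesian_product card_box_polys)
  also have "card (box_polys j H \<times> ?G) \<le> card (primitive_polys k H)"
  proof (rule card_inj_on_le)
    show "inj_on (\<lambda>(g, x, y). pCons x (pCons y g)) (box_polys j H \<times> ?G)" by (auto intro!: inj_onI)
    show "(\<lambda>(g, x, y). pCons x (pCons y g)) ` (box_polys j H \<times> ?G) \<subseteq> primitive_polys k H"
    proof safe
      fix g x y assume *: "g \<in> box_polys j H" "x \<in> {1..H}" "y \<in> {1..H}" "coprime x y"
      have "pCons x (pCons y g) \<in> box_polys k H"
        unfolding j using * H by (auto simp: pCons_in_box_polys)
      moreover have "content (pCons x (pCons y g)) = 1"
        using * by (simp add: content_pCons_int gcd.assoc[symmetric])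
      ultimately show "pCons x (pCons y g) \<in> primitive_polys k H"
        using H by (simp add: primitive_polys_eq)
    qed
    show "finite (primitive_polys k H)" using H by (simp add: primitive_polys_eq finite_box_polys)
  qed
  finally show ?thesis by simp
qed

section \<open>The density series\<close>

definition density_term :: "int poly \<Rightarrow> nat \<Rightarrow> real" where
  "density_term f d = real_of_int (moebius_mu d) * (real (root_count f (d\<^sup>2)) / (real d)\<^sup>2)"

lemma sqfree_density_eq: "sqfree_density f = (\<Sum>j. density_term f (Suc j))"
  by (simp add: sqfree_density_def density_term_def Let_def)

lemma powr_minus_le_one:
  fixes x s :: real
  assumes "x \<ge> 1" "s \<ge> 0"
  shows "x powr (- s) \<le> 1"
  using powr_mono[of "- s" 0 x] assms by simp

text \<open>The value \<open>\<Delta> = 0\<close> is allowed: the gcd is then \<open>d\<close>, and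
  the bound becomes \<open>k\<close> to the number of prime factors of \<open>d\<close>, divided by
  \<open>d\<close>, for every primitive \<open>f\<close>.\<close>

lemma abs_density_term_le:
  assumes f: "content f = 1" "degree f \<le> k" and uv: "u * f + v * pderiv f = [:\<Delta>:]"
  shows "\<bar>density_term f d\<bar>
    \<le> of_bool (squarefree d) * (real k ^ card (prime_factors d) * real (gcd d (nat \<bar>\<Delta>\<bar>)) / (real d)\<^sup>2)"
proof (cases "squarefree d")
  case True
  have "real (root_count f (d\<^sup>2)) \<le> real (k ^ card (prime_factors d) * gcd d (nat \<bar>\<Delta>\<bar>))"
    using root_count_squarefree_square_le[OF True f uv] by (rule of_nat_mono)
  hence le: "real (root_count f (d\<^sup>2)) / (real d)\<^sup>2
      \<le> real k ^ card (prime_factors d) * real (gcd d (nat \<bar>\<Delta>\<bar>)) / (real d)\<^sup>2"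
    by (intro divide_right_mono) simp_all
  have "\<bar>density_term f d\<bar> \<le> 1 * (real (root_count f (d\<^sup>2)) / (real d)\<^sup>2)"
    unfolding density_term_def abs_mult by (intro mult_mono moebius_mu_abs_le) auto
  thus ?thesis using le True by simp
qed (simp add: density_term_def moebius_mu_def)

section \<open>Tails of the density series for separable polynomials\<close>

text \<open>The uniform bound on absolute partial sums gives convergence as well as the estimate, so
  \<open>suminf\<close> is a genuine sum here. The head \<open>1..N\<close> corresponds to the
  series indices below \<open>N\<close>.\<close>

lemma suminf_tail_bound:
  fixes a :: "nat \<Rightarrow> real"
  assumes B: "\<And>X. (\<Sum>d\<in>{N<..X}. \<bar>a d\<bar>) \<le> B"
  shows "\<bar>(\<Sum>d=1..N. a d) - (\<Sum>j. a (Suc j))\<bar> \<le> B"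
proof -
  let ?g = "\<lambda>j. a (Suc (j + N))"
  have part: "(\<Sum>j<n. \<bar>?g j\<bar>) \<le> B" for n
  proof -
    have "(\<Sum>j<n. \<bar>?g j\<bar>) = (\<Sum>d\<in>{N<..N + n}. \<bar>a d\<bar>)"
      by (rule sum.reindex_bij_witness[of _ "\<lambda>d. d - Suc N" "\<lambda>j. Suc (j + N)"]) auto
    thus ?thesis using B by simp
  qed
  have abs: "summable (\<lambda>j. \<bar>?g j\<bar>)" by (rule summableI_nonneg_bounded[OF _ part]) simp
  hence "summable ?g" by (rule summable_rabs_cancel)
  hence sm: "summable (\<lambda>j. a (Suc j))" using summable_iff_shift[of "\<lambda>j. a (Suc j)" N] by simp
  have "(\<Sum>j. a (Suc j)) = (\<Sum>j. ?g j) + (\<Sum>j<N. a (Suc j))"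
    using suminf_split_initial_segment[OF sm, of N] by simp
  moreover have "(\<Sum>j<N. a (Suc j)) = (\<Sum>d=1..N. a d)"
    by (rule sum.reindex_bij_witness[of _ "\<lambda>d. d - 1" Suc]) auto
  moreover have "\<bar>\<Sum>j. ?g j\<bar> \<le> (\<Sum>j. \<bar>?g j\<bar>)" by (rule summable_rabs[OF abs])
  moreover have "(\<Sum>j. \<bar>?g j\<bar>) \<le> B" by (rule suminf_le_const[OF abs part])
  ultimately show ?thesis by linarith
qed

text \<open>For squarefree \<open>d\<close> the gcd is one of the squarefree divisors
  \<open>g\<close> of \<open>m\<close>. Weakening "the gcd is \<open>g\<close>" to "\<open>g\<close>
  divides \<open>d\<close>" and writing \<open>d = g * t\<close>, the weight is at most
  \<open>t powr (- 1 - \<eta>)\<close>, so each \<open>g\<close> costs one convergent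
  series.\<close>

lemma sum_gcd_powr_le:
  fixes m :: nat and \<eta> :: real
  assumes m: "m > 0" and \<eta>: "\<eta> > 0"
  shows "(\<Sum>d=1..X. of_bool (squarefree d) * (real (gcd d m) * real d powr (- 1 - \<eta>)))
    \<le> 2 ^ card (prime_factors m) * (\<Sum>j. real (Suc j) powr (- 1 - \<eta>))"
proof -
  let ?E = "{g. squarefree g \<and> g dvd m}"
  let ?Z = "\<Sum>j. real (Suc j) powr (- 1 - \<eta>)"
  have finE: "finite ?E" using m by (intro finite_subset[OF _ finite_divisors_nat[of m]]) auto
  have smZ: "summable (\<lambda>j. real (Suc j) powr (- 1 - \<eta>))"
    using \<eta> by (subst summable_Suc_iff) (simp add: summable_real_powr_iff)
  have Z0: "?Z \<ge> 0" by (intro suminf_nonneg smZ) simp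
  have part: "(\<Sum>t=1..X. real t powr (- 1 - \<eta>)) \<le> ?Z"
  proof -
    have "(\<Sum>t=1..X. real t powr (- 1 - \<eta>)) = (\<Sum>j<X. real (Suc j) powr (- 1 - \<eta>))"
      by (rule sum.reindex_bij_witness[of _ Suc "\<lambda>d. d - 1"]) auto
    thus ?thesis using sum_le_suminf[OF smZ, of "{..<X}"] by simp
  qed
  have "(\<Sum>d=1..X. of_bool (squarefree d) * (real (gcd d m) * real d powr (- 1 - \<eta>)))
      \<le> (\<Sum>d=1..X. \<Sum>g\<in>?E. of_bool (g dvd d) * (real g * real d powr (- 1 - \<eta>)))"
  proof (rule sum_mono)
    fix d
    show "of_bool (squarefree d) * (real (gcd d m) * real d powr (- 1 - \<eta>))
        \<le> (\<Sum>g\<in>?E. of_bool (g dvd d) * (real g * real d powr (- 1 - \<eta>)))"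
    proof (cases "squarefree d")
      case True
      hence "gcd d m \<in> ?E" by (auto intro: squarefree_mono[of "gcd d m" d])
      from member_le_sum[OF this _ finE, of "\<lambda>g. of_bool (g dvd d) * (real g * real d powr (- 1 - \<eta>))"]
      show ?thesis using True by simp
    next
      case False
      thus ?thesis by (simp add: sum_nonneg)
    qed
  qed
  also have "\<dots> = (\<Sum>g\<in>?E. \<Sum>d=1..X. of_bool (g dvd d) * (real g * real d powr (- 1 - \<eta>)))"
    by (rule sum.swap)
  also have "\<dots> \<le> (\<Sum>g\<in>?E. ?Z)"
  proof (rule sum_mono)
    fix g assume g: "g \<in> ?E"
    hence g0: "g > 0" using m by (auto intro!: Nat.gr0I)
    have "(\<Sum>d=1..X. of_bool (g dvd d) * (real g * real d powr (- 1 - \<eta>)))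
        = (\<Sum>d\<in>{d \<in> {1..X}. g dvd d}. real g * real d powr (- 1 - \<eta>))"
      by (rule sum.mono_neutral_cong_right) auto
    also have "\<dots> \<le> (\<Sum>d\<in>(\<lambda>t. g * t) ` {1..X}. real g * real d powr (- 1 - \<eta>))"
    proof (rule sum_mono2)
      show "{d \<in> {1..X}. g dvd d} \<subseteq> (\<lambda>t. g * t) ` {1..X}"
      proof
        fix d assume d: "d \<in> {d \<in> {1..X}. g dvd d}"
        then obtain t where t: "d = g * t" by (auto elim: dvdE)
        have "t \<le> g * t" using g0 by simp
        hence "t \<in> {1..X}" using d t by (cases t) auto
        thus "d \<in> (\<lambda>t. g * t) ` {1..X}" using t by blast
      qed
    qed auto
    also have "\<dots> = (\<Sum>t=1..X. real g * real (g * t) powr (- 1 - \<eta>))"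
      using g0 by (subst sum.reindex) (auto intro!: inj_onI)
    also have "\<dots> \<le> (\<Sum>t=1..X. real t powr (- 1 - \<eta>))"
    proof (rule sum_mono)
      fix t
      have "real g * real (g * t) powr (- 1 - \<eta>) = (real g powr 1 * real g powr (- 1 - \<eta>)) * real t powr (- 1 - \<eta>)"
        using g0 by (simp add: powr_mult)
      also have "real g powr 1 * real g powr (- 1 - \<eta>) = real g powr (- \<eta>)"
        by (subst powr_add[symmetric]) simp
      also have "\<dots> \<le> 1" using g0 \<eta> by (intro powr_minus_le_one) auto
      finally show "real g * real (g * t) powr (- 1 - \<eta>) \<le> real t powr (- 1 - \<eta>)"
        by (simp add: mult_right_mono)
    qed
    also have "\<dots> \<le> ?Z" by (rule part)
    finally show "(\<Sum>d=1..X. of_bool (g dvd d) * (real g * real d powr (- 1 - \<eta>))) \<le> ?Z" .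
  qed
  also have "\<dots> = real (card ?E) * ?Z" by simp
  also have "\<dots> \<le> 2 ^ card (prime_factors m) * ?Z"
  proof (rule mult_right_mono[OF _ Z0])
    have "real (card ?E) \<le> real (2 ^ card (prime_factors m))"
      using card_squarefree_divisors[OF m] by (rule of_nat_mono)
    thus "real (card ?E) \<le> 2 ^ card (prime_factors m)" by simp
  qed
  finally show ?thesis .
qed

text \<open>Rankin's trick: for \<open>d > N\<close> the weight \<open>d powr (\<eta> - 2)\<close> is at most
  \<open>N powr (2 * \<eta> - 1) * d powr (- 1 - \<eta>)\<close>.\<close>

lemma sqfree_density_tail:
  fixes \<eta> :: real and k :: nat
  assumes \<eta>: "0 < \<eta>" "\<eta> \<le> 1/2" and k: "k \<ge> 1"
  shows "\<exists>C>0. \<forall>f u v \<Delta> N. content f = 1 \<and> degree f \<le> k \<and> u * f + v * pderiv f = [:\<Delta>:] \<and> \<Delta> \<noteq> 0 \<and> N \<ge> 1 \<longrightarrow>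
    \<bar>(\<Sum>d=1..N. density_term f d) - sqfree_density f\<bar> \<le> C * \<bar>real_of_int \<Delta>\<bar> powr \<eta> * real N powr (2 * \<eta> - 1)"
proof -
  obtain C1 where C1: "C1 \<ge> 1" "\<And>d::nat. d > 0 \<Longrightarrow> real k ^ card (prime_factors d) \<le> C1 * real d powr \<eta>"
    using power_card_prime_factors_bound[of "real k" \<eta>] k \<eta> by auto
  obtain C2 where C2: "C2 \<ge> 1" "\<And>m::nat. m > 0 \<Longrightarrow> 2 ^ card (prime_factors m) \<le> C2 * real m powr \<eta>"
    using power_card_prime_factors_bound[of 2 \<eta>] \<eta> by auto
  define Z where "Z = (\<Sum>j. real (Suc j) powr (- 1 - \<eta>))"
  have smZ: "summable (\<lambda>j. real (Suc j) powr (- 1 - \<eta>))"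
    using \<eta> by (subst summable_Suc_iff) (simp add: summable_real_powr_iff)
  have Z0: "Z > 0" unfolding Z_def by (intro suminf_pos smZ) simp
  define C where "C = C1 * C2 * Z"
  have "\<bar>(\<Sum>d=1..N. density_term f d) - sqfree_density f\<bar> \<le> C * \<bar>real_of_int \<Delta>\<bar> powr \<eta> * real N powr (2 * \<eta> - 1)"
    if f: "content f = 1" "degree f \<le> k" and uv: "u * f + v * pderiv f = [:\<Delta>:]" and \<Delta>: "\<Delta> \<noteq> 0" and N: "N \<ge> 1"
    for f u v \<Delta> N
    unfolding sqfree_density_eq
  proof (rule suminf_tail_bound)
    fix X :: nat
    define m where "m = nat \<bar>\<Delta>\<bar>"
    have m: "m > 0" "real m = \<bar>real_of_int \<Delta>\<bar>" using \<Delta> by (auto simp: m_def)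
    define b where "b = (\<lambda>d. of_bool (squarefree d) * (real (gcd d m) * real d powr (- 1 - \<eta>)))"
    have b0: "b d \<ge> 0" for d by (simp add: b_def)
    have "(\<Sum>d\<in>{N<..X}. \<bar>density_term f d\<bar>) \<le> (\<Sum>d\<in>{N<..X}. C1 * real N powr (2 * \<eta> - 1) * b d)"
    proof (rule sum_mono)
      fix d assume d: "d \<in> {N<..X}"
      hence d0: "d > 0" by auto
      have "real k ^ card (prime_factors d) * real (gcd d m) / (real d)\<^sup>2
          \<le> C1 * real d powr \<eta> * real (gcd d m) / (real d)\<^sup>2"
        using C1(2)[OF d0] by (intro divide_right_mono mult_right_mono) auto
      also have "\<dots> = C1 * (real d powr \<eta> / real d powr 2) * real (gcd d m)"
        using d0 by (simp add: powr_realpow)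
      also have "real d powr \<eta> / real d powr 2 = real d powr (2 * \<eta> - 1) * real d powr (- 1 - \<eta>)"
        unfolding powr_diff[symmetric] powr_add[symmetric] by (rule arg_cong[of _ _ "(powr) (real d)"]) simp
      also have "C1 * (real d powr (2 * \<eta> - 1) * real d powr (- 1 - \<eta>)) * real (gcd d m)
          \<le> C1 * (real N powr (2 * \<eta> - 1) * real d powr (- 1 - \<eta>)) * real (gcd d m)"
        using C1(1) d \<eta> N by (intro mult_right_mono mult_left_mono powr_mono2') auto
      finally have "real k ^ card (prime_factors d) * real (gcd d m) / (real d)\<^sup>2
          \<le> C1 * real N powr (2 * \<eta> - 1) * (real (gcd d m) * real d powr (- 1 - \<eta>))"
        by (simp add: mult_ac)
      thus "\<bar>density_term f d\<bar> \<le> C1 * real N powr (2 * \<eta> - 1) * b d"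
        using abs_density_term_le[OF f uv, of d] by (cases "squarefree d") (auto simp: b_def m_def)
    qed
    also have "\<dots> = C1 * real N powr (2 * \<eta> - 1) * (\<Sum>d\<in>{N<..X}. b d)" by (simp add: sum_distrib_left)
    also have "\<dots> \<le> C1 * real N powr (2 * \<eta> - 1) * (C2 * real m powr \<eta> * Z)"
    proof (rule mult_left_mono)
      have "(\<Sum>d\<in>{N<..X}. b d) \<le> (\<Sum>d=1..X. b d)" by (rule sum_mono2) (auto simp: b0)
      also have "\<dots> \<le> 2 ^ card (prime_factors m) * Z"
        unfolding b_def Z_def by (rule sum_gcd_powr_le[OF m(1) \<eta>(1)])
      also have "\<dots> \<le> C2 * real m powr \<eta> * Z" using C2(2)[OF m(1)] Z0 by (intro mult_right_mono) auto
      finally show "(\<Sum>d\<in>{N<..X}. b d) \<le> C2 * real m powr \<eta> * Z" .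
    qed (use C1 in simp)
    finally show "(\<Sum>d\<in>{N<..X}. \<bar>density_term f d\<bar>) \<le> C * \<bar>real_of_int \<Delta>\<bar> powr \<eta> * real N powr (2 * \<eta> - 1)"
      using m(2) by (simp add: C_def mult_ac)
  qed
  moreover have "C > 0" using C1 C2 Z0 by (simp add: C_def)
  ultimately show ?thesis by blast
qed

section \<open>Boundedness of the density for all primitive polynomials\<close>

text \<open>The sum over squarefree numbers built from primes up to \<open>n\<close> is an Euler
  product with factors in [0,1], hence at most 1. It contains all squarefree \<open>d\<close> up to
  \<open>n\<close>; the surplus consists of terms with \<open>d > n\<close>, a tail of an absolutely
  convergent series, of size at most 1 for large \<open>n\<close>.\<close>

lemma density_dirichlet_partial_sum_bound:
  fixes s :: real
  assumes f: "content f = 1" "degree f \<le> k" and k: "k \<ge> 1" and s: "s > 0"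
  shows "\<exists>n0. \<forall>n\<ge>n0. \<bar>\<Sum>d=1..n. density_term f d * real d powr (- s)\<bar> \<le> 2"
proof -
  obtain C1 where C1: "C1 \<ge> 1" "\<And>d::nat. d > 0 \<Longrightarrow> real k ^ card (prime_factors d) \<le> C1 * real d powr (s/2)"
    using power_card_prime_factors_bound[of "real k" "s/2"] k s by auto
  define \<beta> where "\<beta> = (\<lambda>d::nat. C1 * real d powr (- 1 - s/2))"
  have \<beta>: "\<bar>density_term f d * real d powr (- s)\<bar> \<le> \<beta> d" if d: "d > 0" for d
  proof -
    \<comment> \<open>Taking \<open>\<Delta> = 0\<close> with zero multipliers covers nonseparable
      \<open>f\<close> too; the loss in the gcd is made up by the factor
      \<open>d powr (- s)\<close>.\<close>
    have "\<bar>density_term f d\<bar> \<le> of_bool (squarefree d) * (real k ^ card (prime_factors d) * real (gcd d (nat \<bar>0\<bar>)) / (real d)\<^sup>2)"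
      by (rule abs_density_term_le[OF f, of 0 0]) simp
    also have "\<dots> \<le> real k ^ card (prime_factors d) * real d / (real d)\<^sup>2" by simp
    also have "\<dots> = real k ^ card (prime_factors d) / real d" using d by (simp add: power2_eq_square)
    also have "\<dots> \<le> C1 * real d powr (s/2) / real d" using C1(2)[OF d] by (intro divide_right_mono) auto
    finally have "\<bar>density_term f d\<bar> * real d powr (- s) \<le> C1 * real d powr (s/2) / real d * real d powr (- s)"
      by (rule mult_right_mono) simp
    also have "\<dots> = C1 * (real d powr (s/2) * real d powr (- 1) * real d powr (- s))"
      using d by (simp add: powr_minus field_simps)
    also have "\<dots> = \<beta> d" unfolding \<beta>_def powr_add[symmetric]
      by (rule arg_cong[of _ _ "\<lambda>x. C1 * real d powr x"]) simp
    finally show ?thesis by (simp add: abs_mult)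
  qed
  have "summable \<beta>" unfolding \<beta>_def using s by (intro summable_mult) (simp add: summable_real_powr_iff)
  then obtain n0 where n0: "\<And>m n. m \<ge> n0 \<Longrightarrow> norm (sum \<beta> {m..<n}) < 1"
    unfolding summable_Cauchy by (meson zero_less_one)
  have "\<bar>\<Sum>d=1..n. density_term f d * real d powr (- s)\<bar> \<le> 2" if n: "n \<ge> n0" for n
  proof -
    define S where "S = {p. prime p \<and> p \<le> n}"
    have S: "finite S" "\<And>p. p \<in> S \<Longrightarrow> prime p" by (auto simp: S_def)
    let ?E = "{d. squarefree d \<and> prime_factors d \<subseteq> S}"
    define h where "h = (\<lambda>d. real (root_count f (d\<^sup>2)) / (real d)\<^sup>2 * real d powr (- s))"
    have finE: "finite ?E"
      using bij_betw_finite[OF squarefree_prime_support[OF S]] S(1) by simp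
    have E0: "d > 0" if "d \<in> ?E" for d using that by (auto intro!: Nat.gr0I)
    have "(\<Sum>d\<in>?E. density_term f d * real d powr (- s)) = (\<Sum>d\<in>?E. of_int (moebius_mu d) * h d)"
      by (simp add: h_def density_term_def mult_ac)
    also have "\<dots> = (\<Prod>p\<in>S. 1 - h p)"
    proof (rule sum_moebius_euler_product[OF S])
      fix T assume T: "T \<subseteq> S"
      hence "finite T" "\<And>p. p \<in> T \<Longrightarrow> prime p" using S finite_subset by auto
      hence "root_count f ((\<Prod>T)\<^sup>2) = (\<Prod>p\<in>T. root_count f (p\<^sup>2))" by (rule root_count_prod_primes_square)
      thus "h (\<Prod>T) = (\<Prod>p\<in>T. h p)"
        by (simp add: h_def prod.distrib prod_dividef prod_power_distrib prod_powr_distrib)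
    qed
    finally have euler: "(\<Sum>d\<in>?E. density_term f d * real d powr (- s)) = (\<Prod>p\<in>S. 1 - h p)" .
    have h01: "0 \<le> h p \<and> h p \<le> 1" if "p \<in> S" for p
    proof -
      have p: "p \<ge> 1" using S(2)[OF that] prime_ge_1_nat by blast
      have "real (root_count f (p\<^sup>2)) \<le> (real p)\<^sup>2" using root_count_le[of f "p\<^sup>2"] by (metis of_nat_mono of_nat_power)
      hence "real (root_count f (p\<^sup>2)) / (real p)\<^sup>2 \<le> 1" using p by simp
      moreover have "real p powr (- s) \<le> 1" using p s by (simp add: powr_minus_le_one)
      ultimately have "h p \<le> 1 * 1" unfolding h_def by (intro mult_mono) auto
      thus ?thesis by (simp add: h_def)
    qed
    have prod: "0 \<le> (\<Prod>p\<in>S. 1 - h p)" "(\<Prod>p\<in>S. 1 - h p) \<le> 1"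
      using h01 by (auto intro!: prod_nonneg prod_le_1)
    have "(\<Sum>d=1..n. density_term f d * real d powr (- s)) = (\<Sum>d\<in>?E \<inter> {1..n}. density_term f d * real d powr (- s))"
    proof (rule sum.mono_neutral_right)
      show "\<forall>d\<in>{1..n} - ?E \<inter> {1..n}. density_term f d * real d powr (- s) = 0"
      proof
        fix d assume d: "d \<in> {1..n} - ?E \<inter> {1..n}"
        have "\<not> squarefree d"
        proof
          assume "squarefree d"
          then obtain p where p: "p \<in> prime_factors d" "p \<notin> S" using d by auto
          have "p dvd d" using p by auto
          hence "p \<le> d" using d by (intro dvd_imp_le) auto
          thus False using p d by (auto simp: S_def)
        qed
        thus "density_term f d * real d powr (- s) = 0" by (simp add: density_term_def moebius_mu_def)
      qed
    qed auto
    also have "\<dots> = (\<Sum>d\<in>?E. density_term f d * real d powr (- s)) - (\<Sum>d\<in>?E - {1..n}. density_term f d * real d powr (- s))"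
      using sum.Int_Diff[OF finE, of "\<lambda>d. density_term f d * real d powr (- s)" "{1..n}"] by simp
    finally have eq: "(\<Sum>d=1..n. density_term f d * real d powr (- s))
        = (\<Prod>p\<in>S. 1 - h p) - (\<Sum>d\<in>?E - {1..n}. density_term f d * real d powr (- s))" by (simp add: euler)
    have "\<bar>\<Sum>d\<in>?E - {1..n}. density_term f d * real d powr (- s)\<bar> \<le> (\<Sum>d\<in>?E - {1..n}. \<beta> d)"
      by (rule order.trans[OF sum_abs], rule sum_mono, rule \<beta>) (use E0 in auto)
    also have "\<dots> \<le> (\<Sum>d\<in>{n..<Suc (Max (insert 0 ?E))}. \<beta> d)"
    proof (rule sum_mono2)
      show "?E - {1..n} \<subseteq> {n..<Suc (Max (insert 0 ?E))}"
      proof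
        fix d assume d: "d \<in> ?E - {1..n}"
        hence "d \<le> Max (insert 0 ?E)" using finE by (intro Max_ge) auto
        moreover have "d > n" using d E0[of d] by auto
        ultimately show "d \<in> {n..<Suc (Max (insert 0 ?E))}" by simp
      qed
      show "\<And>d. 0 \<le> \<beta> d" using C1 by (simp add: \<beta>_def)
    qed simp
    also have "\<dots> \<le> 1" using n0[OF n, of "Suc (Max (insert 0 ?E))"] by simp
    finally show ?thesis unfolding eq using prod by linarith
  qed
  thus ?thesis by blast
qed

lemma sum_by_parts:
  fixes a w :: "nat \<Rightarrow> real"
  shows "(\<Sum>j<n. a j * w j) = (\<Sum>j<n. a j) * w n + (\<Sum>j<n. (\<Sum>i<Suc j. a i) * (w j - w (Suc j)))"
  by (induction n) (simp_all add: algebra_simps)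

text \<open>Abel's theorem for Dirichlet series: the sum is the limit as \<open>s\<close> tends to 0 of series
  that are Euler products with factors between 0 and 1.\<close>

lemma abs_sqfree_density_summable:
  assumes f: "content f = 1" "degree f \<le> k" and k: "k \<ge> 1"
    and sm: "summable (\<lambda>j. density_term f (Suc j))"
  shows "\<bar>sqfree_density f\<bar> \<le> 5"
proof -
  define a where "a = (\<lambda>j. density_term f (Suc j))"
  define c where "c = sqfree_density f"
  define e where "e = (\<lambda>n. (\<Sum>j<n. a j) - c)"
  have "(\<lambda>n. \<Sum>j<n. a j) \<longlonglongrightarrow> c"
    using summable_LIMSEQ[OF sm] by (simp add: a_def c_def sqfree_density_eq)
  hence lim: "e \<longlonglongrightarrow> 0" unfolding e_def by (simp add: LIM_zero_iff)
  then obtain J where J: "\<And>n. n \<ge> J \<Longrightarrow> \<bar>e n\<bar> < 1"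
    using LIMSEQ_D[OF lim, of 1] by auto
  obtain M where M: "M > 0" "\<And>n. \<bar>e n\<bar> \<le> M"
    using convergent_imp_Bseq[OF convergentI[OF lim]] by (auto elim!: BseqE)
  \<comment> \<open>The exponent \<open>s\<close> is chosen after \<open>J\<close> and
    \<open>M\<close>, so small that the weights hardly vary on the first \<open>J\<close> indices;
    the possibly large errors there then contribute less than 1.\<close>
  have "((\<lambda>s. M * (1 - real (Suc J) powr (- s))) \<longlongrightarrow> M * (1 - real (Suc J) powr (- 0))) (at_right 0)"
    by (intro tendsto_intros) auto
  hence "eventually (\<lambda>s. M * (1 - real (Suc J) powr (- s)) < 1) (at_right 0)"
    by (intro order_tendstoD) auto
  moreover have "eventually (\<lambda>s. s > (0::real)) (at_right 0)" by (rule eventually_at_right_less)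
  ultimately have "eventually (\<lambda>s. s > 0 \<and> M * (1 - real (Suc J) powr (- s)) < 1) (at_right 0)"
    by eventually_elim auto
  then obtain s :: real where s: "s > 0" "M * (1 - real (Suc J) powr (- s)) < 1"
    using eventually_happens[of _ "at_right (0::real)"] by (auto simp: trivial_limit_at_right_real)
  define w where "w = (\<lambda>j. real (Suc j) powr (- s))"
  have w0: "w 0 = 1" by (simp add: w_def)
  have wn: "w n \<ge> 0" for n by (simp add: w_def)
  have wd: "w j - w (Suc j) \<ge> 0" for j using s by (simp add: w_def powr_mono2')
  have tele: "(\<Sum>j<n. w j - w (Suc j)) = 1 - w n" for n
    using sum_lessThan_telescope'[of w n] w0 by simp
  obtain n0 where n0: "\<And>n. n \<ge> n0 \<Longrightarrow> \<bar>\<Sum>d=1..n. density_term f d * real d powr (- s)\<bar> \<le> 2"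
    using density_dirichlet_partial_sum_bound[OF f k s(1)] by blast
  define n where "n = max n0 J"
  have "(\<Sum>j<n. a j * w j) = (\<Sum>d=1..n. density_term f d * real d powr (- s))"
    unfolding a_def w_def by (rule sum.reindex_bij_witness[of _ "\<lambda>d. d - 1" Suc]) auto
  hence D: "\<bar>\<Sum>j<n. a j * w j\<bar> \<le> 2" using n0[of n] by (simp add: n_def)
  have "(\<Sum>j<n. a j * w j) = (e n + c) * w n + (\<Sum>j<n. (e (Suc j) + c) * (w j - w (Suc j)))"
    using sum_by_parts[of a w n] by (simp add: e_def)
  also have "\<dots> = c * w n + c * (\<Sum>j<n. w j - w (Suc j)) + e n * w n + (\<Sum>j<n. e (Suc j) * (w j - w (Suc j)))"
    by (simp add: algebra_simps sum.distrib sum_subtractf sum_distrib_left)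
  also have "\<dots> = c + e n * w n + (\<Sum>j<n. e (Suc j) * (w j - w (Suc j)))"
    unfolding tele by (simp add: algebra_simps)
  \<comment> \<open>The three terms are bounded by 2, 1 and 2, which gives the constant 5.\<close>
  finally have c: "c = (\<Sum>j<n. a j * w j) - e n * w n - (\<Sum>j<n. e (Suc j) * (w j - w (Suc j)))" by simp
  have "\<bar>e n * w n\<bar> \<le> 1 * 1"
    unfolding abs_mult using J[of n] w0 wd s
    by (intro mult_mono) (auto simp: n_def w_def powr_minus_le_one)
  moreover have "\<bar>\<Sum>j<n. e (Suc j) * (w j - w (Suc j))\<bar> \<le> 2"
  proof -
    have "\<bar>\<Sum>j<n. e (Suc j) * (w j - w (Suc j))\<bar>
        \<le> (\<Sum>j<n. (w j - w (Suc j)) + of_bool (j < J) * (M * (w j - w (Suc j))))"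
    proof (rule order.trans[OF sum_abs], rule sum_mono)
      fix j
      show "\<bar>e (Suc j) * (w j - w (Suc j))\<bar> \<le> (w j - w (Suc j)) + of_bool (j < J) * (M * (w j - w (Suc j)))"
      proof (cases "j < J")
        case True
        have "\<bar>e (Suc j)\<bar> * (w j - w (Suc j)) \<le> M * (w j - w (Suc j))"
          using M(2) wd by (intro mult_right_mono)
        thus ?thesis using True wd[of j] by (simp add: abs_mult)
      next
        case False
        have "\<bar>e (Suc j)\<bar> * (w j - w (Suc j)) \<le> 1 * (w j - w (Suc j))"
          using J[of "Suc j"] False wd by (intro mult_right_mono) auto
        thus ?thesis using False wd[of j] by (simp add: abs_mult)
      qed
    qed
    also have "\<dots> = (\<Sum>j<n. w j - w (Suc j)) + (\<Sum>j<n. of_bool (j < J) * (M * (w j - w (Suc j))))"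
      by (rule sum.distrib)
    also have "(\<Sum>j<n. of_bool (j < J) * (M * (w j - w (Suc j)))) = (\<Sum>j<J. M * (w j - w (Suc j)))"
      by (rule sum.mono_neutral_cong_right) (auto simp: n_def)
    also have "(\<Sum>j<n. w j - w (Suc j)) + (\<Sum>j<J. M * (w j - w (Suc j))) = (1 - w n) + M * (1 - w J)"
      unfolding sum_distrib_left[symmetric] tele ..
    also have "M * (1 - w J) < 1" using s(2) by (simp only: w_def)
    hence "(1 - w n) + M * (1 - w J) \<le> 2" using wn[of n] by linarith
    finally show ?thesis .
  qed
  ultimately show ?thesis using D c unfolding c_def by linarith
qed

text \<open>When the series diverges, \<^const>\<open>suminf\<close> returns a fixed junk value.\<close>

lemma abs_sqfree_density_le:
  "\<exists>K>0. \<forall>f. content f = 1 \<longrightarrow> \<bar>sqfree_density f\<bar> \<le> K"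
proof -
  define K where "K = max 5 \<bar>THE s :: real. False\<bar>"
  have "\<bar>sqfree_density f\<bar> \<le> K" if f: "content f = 1" for f
  proof (cases "summable (\<lambda>j. density_term f (Suc j))")
    case True
    have "\<bar>sqfree_density f\<bar> \<le> 5"
      by (rule abs_sqfree_density_summable[OF f _ _ True, of "Suc (degree f)"]) auto
    thus ?thesis by (simp add: K_def)
  next
    case False
    hence "\<not> (\<lambda>j. density_term f (Suc j)) sums s" for s by (auto simp: summable_def)
    hence "sqfree_density f = (THE s. False)" by (simp add: sqfree_density_eq suminf_def)
    thus ?thesis by (simp add: K_def)
  qed
  moreover have "K > 0" by (simp add: K_def)
  ultimately show ?thesis by blast
qed

section \<open>The average over primitive polynomials\<close>

definition truncated_count :: "int poly \<Rightarrow> nat \<Rightarrow> real" where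
  "truncated_count f N =
     (\<Sum>d=1..N. real_of_int (moebius_mu d) * real (card {n \<in> {1..N}. (int d)\<^sup>2 dvd poly f (int n)}))"

definition truncated_density :: "int poly \<Rightarrow> nat \<Rightarrow> real" where
  "truncated_density f N = (\<Sum>d=1..N. density_term f d)"

lemma primitive_polys_finite_subset:
  assumes "H \<ge> 0"
  shows "finite (primitive_polys k H)" "primitive_polys k H \<subseteq> box_polys k H"
  using finite_box_polys[OF assms] by (auto simp: primitive_polys_eq[OF assms])

lemma double_plus_one_power_le:
  assumes "H \<ge> 1"
  shows "(2 * real_of_int H + 1) ^ k \<le> 3 ^ k * real_of_int H ^ k"
  unfolding power_mult_distrib[symmetric] using assms by (intro power_mono) auto

text \<open>After passing to absolute values the sum may be enlarged to the whole box. Summing the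
  pointwise error over the \<open>N\<close> points cancels the \<open>1 / N\<close>, and the
  contribution of the value 0 is controlled by \<open>N\<^sup>2\<close> being at most
  \<open>H\<close>.\<close>

lemma sum_squarefree_count_truncation:
  fixes H :: int
  assumes N: "N \<ge> 1" and H: "real N ^ 3 \<le> real_of_int H"
  shows "\<bar>\<Sum>f\<in>primitive_polys k H. real (squarefree_count f N) - truncated_count f N\<bar>
    \<le> 3 ^ k * (2 * real k + 3) * real_of_int H ^ (k + 1)"
proof -
  let ?E = "\<lambda>f n. of_bool (squarefree (poly f (int n)))
      - (\<Sum>d=1..N. real_of_int (moebius_mu d) * of_bool ((int d)\<^sup>2 dvd poly f (int n))) :: real"
  have N1: "real N \<ge> 1" using N by simp
  have "real N \<le> real N ^ 3" using N1 by (simp add: self_le_power)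
  moreover have "real N ^ 2 \<le> real N ^ 3" using N1 by (intro power_increasing) auto
  ultimately have NH: "real N \<le> real_of_int H" and N2H: "(real N)\<^sup>2 \<le> real_of_int H" using H by linarith+
  have H1: "H \<ge> 1" "int N \<le> H" using NH N1 by linarith+
  have H0: "H \<ge> 0" using H1 by simp
  have diff: "real (squarefree_count f N) - truncated_count f N = (\<Sum>n=1..N. ?E f n)" for f
  proof -
    have "{n. 1 \<le> n \<and> n \<le> N \<and> squarefree (poly f (int n))} = {n \<in> {1..N}. squarefree (poly f (int n))}" by auto
    hence "real (squarefree_count f N) = (\<Sum>n=1..N. of_bool (squarefree (poly f (int n))))"
      by (simp add: squarefree_count_def Int_def)
    moreover have "truncated_count f N
        = (\<Sum>d=1..N. \<Sum>n=1..N. real_of_int (moebius_mu d) * of_bool ((int d)\<^sup>2 dvd poly f (int n)))"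
      unfolding truncated_count_def by (simp add: sum_distrib_left[symmetric] Int_def)
    moreover have "\<dots> = (\<Sum>n=1..N. \<Sum>d=1..N. real_of_int (moebius_mu d) * of_bool ((int d)\<^sup>2 dvd poly f (int n)))"
      by (rule sum.swap)
    ultimately show ?thesis by (simp only: sum_subtractf)
  qed
  have "\<bar>\<Sum>f\<in>primitive_polys k H. real (squarefree_count f N) - truncated_count f N\<bar>
      \<le> (\<Sum>f\<in>primitive_polys k H. \<Sum>n=1..N. \<bar>?E f n\<bar>)"
    unfolding diff by (intro order.trans[OF sum_abs] sum_mono sum_abs)
  also have "\<dots> \<le> (\<Sum>f\<in>box_polys k H. \<Sum>n=1..N. \<bar>?E f n\<bar>)"
    by (intro sum_mono2 finite_box_polys primitive_polys_finite_subset H0 sum_nonneg) simp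
  also have "\<dots> = (\<Sum>n=1..N. \<Sum>f\<in>box_polys k H. \<bar>?E f n\<bar>)" by (rule sum.swap)
  also have "\<dots> \<le> (\<Sum>n=1..N. 3 ^ k * (real N * real_of_int H ^ k + 2 * real (k + 1) * real_of_int H ^ (k + 1) / real N))"
    by (intro sum_mono sum_box_polys_truncation_error H1) auto
  also have "\<dots> = 3 ^ k * ((real N)\<^sup>2 * real_of_int H ^ k + 2 * real (k + 1) * real_of_int H ^ (k + 1))"
    using N1 by (simp add: field_simps power2_eq_square)
  also have "\<dots> \<le> 3 ^ k * (real_of_int H * real_of_int H ^ k + 2 * real (k + 1) * real_of_int H ^ (k + 1))"
    using N2H H0 by (intro mult_left_mono add_mono mult_right_mono) auto
  also have "\<dots> = 3 ^ k * (2 * real k + 3) * real_of_int H ^ (k + 1)" by (simp add: algebra_simps)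
  finally show ?thesis .
qed

text \<open>The levels \<open>d\<close> up to \<open>N\<close> and the \<open>N\<close> points
  together cost \<open>N\<^sup>2\<close> times the error \<open>H powr (1/3)\<close> for each choice
  of nonconstant coefficients. Since \<open>N\<close> is at most \<open>H powr (1/3)\<close>, this
  product is at most \<open>H\<close>.\<close>

lemma sum_truncated_count_density:
  "\<exists>C>0. \<forall>k N H. k \<ge> 1 \<and> N \<ge> 1 \<and> real N ^ 3 \<le> real_of_int H \<longrightarrow>
    \<bar>\<Sum>f\<in>primitive_polys k H. truncated_count f N - real N * truncated_density f N\<bar>
    \<le> C * 3 ^ k * real_of_int H ^ (k + 1)"
proof -
  obtain C where C: "C > 0" "\<And>k H (d::nat) n n'. H \<ge> 1 \<Longrightarrow> d \<ge> 1 \<Longrightarrow>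
     \<bar>real (card {f \<in> primitive_polys (Suc k) H. (int d)\<^sup>2 dvd poly f n})
      - real (card {f \<in> primitive_polys (Suc k) H. (int d)\<^sup>2 dvd poly f n'})\<bar>
     \<le> C * real_of_int H powr (1/3) * (2 * real_of_int H + 1) ^ Suc k"
    using card_primitive_divisible_diff by blast
  have "\<bar>\<Sum>f\<in>primitive_polys k H. truncated_count f N - real N * truncated_density f N\<bar>
      \<le> C * 3 ^ k * real_of_int H ^ (k + 1)"
    if k: "k \<ge> 1" and N: "N \<ge> 1" and H: "real N ^ 3 \<le> real_of_int H" for k N H
  proof -
    obtain j where j: "k = Suc j" using k by (cases k) auto
    let ?F = "primitive_polys k H"
    define B where "B = C * real_of_int H powr (1/3) * (2 * real_of_int H + 1) ^ k"
    have "1 \<le> real N ^ 3" using N by simp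
    hence H1: "H \<ge> 1" using H by linarith
    let ?D = "\<lambda>d f. real (card {n \<in> {1..N}. (int d)\<^sup>2 dvd poly f (int n)})
        - real N * (real (root_count f (d\<^sup>2)) / (real d)\<^sup>2)"
    have "(\<Sum>f\<in>?F. truncated_count f N - real N * truncated_density f N)
        = (\<Sum>f\<in>?F. \<Sum>d=1..N. real_of_int (moebius_mu d) * ?D d f)"
      by (simp add: truncated_count_def truncated_density_def density_term_def sum_distrib_left
          sum_subtractf right_diff_distrib mult_ac)
    also have "\<dots> = (\<Sum>d=1..N. \<Sum>f\<in>?F. real_of_int (moebius_mu d) * ?D d f)" by (rule sum.swap)
    also have "\<dots> = (\<Sum>d=1..N. real_of_int (moebius_mu d) * (\<Sum>f\<in>?F. ?D d f))"
      by (simp only: sum_distrib_left)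
    finally have eq: "(\<Sum>f\<in>?F. truncated_count f N - real N * truncated_density f N)
        = (\<Sum>d=1..N. real_of_int (moebius_mu d) * (\<Sum>f\<in>?F. ?D d f))" .
    have "\<bar>\<Sum>d=1..N. real_of_int (moebius_mu d) * (\<Sum>f\<in>?F. ?D d f)\<bar> \<le> (\<Sum>d=1..N. 1 * (real N * B))"
    proof (rule order.trans[OF sum_abs], rule sum_mono)
      fix d assume d: "d \<in> {1..N}"
      have "\<bar>\<Sum>f\<in>?F. ?D d f\<bar> \<le> real N * B"
        by (rule sum_primitive_level_error)
          (use C(2)[of H d j] d H1 primitive_polys_finite_subset(1)[of H k] in \<open>auto simp: B_def j simp del: power_Suc\<close>)
      thus "\<bar>real_of_int (moebius_mu d) * (\<Sum>f\<in>?F. ?D d f)\<bar> \<le> 1 * (real N * B)"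
        unfolding abs_mult by (intro mult_mono moebius_mu_abs_le) auto
    qed
    also have "\<dots> = (real N)\<^sup>2 * B" by (simp add: power2_eq_square)
    also have "\<dots> \<le> (real N)\<^sup>2 * (C * real_of_int H powr (1/3) * (3 ^ k * real_of_int H ^ k))"
      unfolding B_def using C(1) H1 by (intro mult_left_mono double_plus_one_power_le) auto
    also have "\<dots> = ((real N)\<^sup>2 * real_of_int H powr (1/3)) * (C * 3 ^ k * real_of_int H ^ k)" by (simp add: mult_ac)
    also have "\<dots> \<le> real_of_int H * (C * 3 ^ k * real_of_int H ^ k)"
    proof (rule mult_right_mono)
      let ?h = "real_of_int H powr (1/3)"
      have "real N = (real N ^ 3) powr (1/3)" using N by (simp add: powr_powr flip: powr_numeral)
      also have "\<dots> \<le> ?h" using H by (intro powr_mono2) auto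
      finally have "(real N)\<^sup>2 * ?h \<le> ?h ^ 2 * ?h" by (intro mult_right_mono power_mono) auto
      also have "\<dots> = ?h ^ 3" by (simp add: power3_eq_cube power2_eq_square)
      also have "\<dots> = real_of_int H" using H1 by (simp add: powr_powr flip: powr_numeral)
      finally show "(real N)\<^sup>2 * ?h \<le> real_of_int H" .
    qed (use C(1) H1 in simp)
    also have "\<dots> = C * 3 ^ k * real_of_int H ^ (k + 1)" by simp
    finally show ?thesis unfolding eq .
  qed
  thus ?thesis using C(1) by blast
qed

lemma abs_truncated_density_le: "\<bar>truncated_density f N\<bar> \<le> real N"
proof -
  have "\<bar>density_term f d\<bar> \<le> 1" if "d \<in> {1..N}" for d
  proof -
    have "real (root_count f (d\<^sup>2)) \<le> (real d)\<^sup>2" using root_count_le[of f "d\<^sup>2"] by (metis of_nat_mono of_nat_power)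
    hence "real (root_count f (d\<^sup>2)) / (real d)\<^sup>2 \<le> 1" using that by simp
    hence "\<bar>density_term f d\<bar> \<le> 1 * 1"
      unfolding density_term_def abs_mult by (intro mult_mono moebius_mu_abs_le) auto
    thus ?thesis by simp
  qed
  hence "(\<Sum>d=1..N. \<bar>density_term f d\<bar>) \<le> (\<Sum>d=1..N. 1)" by (intro sum_mono) auto
  also have "\<dots> = real N" by simp
  finally show ?thesis unfolding truncated_density_def by (rule order.trans[OF sum_abs])
qed

text \<open>For separable \<open>f\<close> the tail bound applies with \<open>\<Delta>\<close>
  polynomial in \<open>H\<close>, hence in \<open>N\<close> because \<open>H\<close> is at most
  \<open>N powr A\<close>. Nonseparable \<open>f\<close> number only \<open>O(H ^ k)\<close> and get
  the trivial bound \<open>N * (1 + K)\<close>; the outer factor \<open>N\<close> makes this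
  \<open>O(N\<^sup>2 * H ^ k)\<close>, which is \<open>O(H ^ (k + 1))\<close>.\<close>

lemma sum_density_tails:
  fixes k :: nat and \<epsilon> A :: real
  assumes k: "k \<ge> 1" and \<epsilon>: "\<epsilon> > 0" and A: "A > 0"
  shows "\<exists>C>0. \<forall>N H. N \<ge> 1 \<and> real N ^ 3 \<le> real_of_int H \<and> real_of_int H \<le> real N powr A \<longrightarrow>
    real N * (\<Sum>f\<in>primitive_polys k H. \<bar>truncated_density f N - sqfree_density f\<bar>)
    \<le> C * real_of_int H ^ (k + 1) * real N powr \<epsilon>"
proof -
  define c :: real where "c = 2 ^ (2 * k)"
  \<comment> \<open>The second entry of the minimum makes the total exponent
    \<open>2 * \<eta> + A * (c * \<eta>)\<close> at most \<open>\<epsilon>\<close>. The cap 1/2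
    keeps \<open>2 * \<eta> - 1\<close> nonpositive, as the tail estimate requires.\<close>
  define \<eta> where "\<eta> = min (1/2) (\<epsilon> / (2 + A * c))"
  have c0: "c > 0" by (simp add: c_def)
  have Ac: "2 + A * c > 0" using A c0 by (simp add: add_pos_pos)
  have "0 < \<eta>" using \<epsilon> Ac by (simp add: \<eta>_def)
  moreover have "\<eta> \<le> 1/2" unfolding \<eta>_def by (rule min.cobounded1)
  ultimately have \<eta>: "0 < \<eta>" "\<eta> \<le> 1/2" .
  have "\<eta> \<le> \<epsilon> / (2 + A * c)" by (simp add: \<eta>_def)
  hence \<eta>\<epsilon>: "2 * \<eta> + A * (c * \<eta>) \<le> \<epsilon>" using Ac by (simp add: field_simps)
  obtain Ct where Ct: "Ct > 0" "\<And>f u v \<Delta> N. content f = 1 \<Longrightarrow> degree f \<le> k \<Longrightarrow> u * f + v * pderiv f = [:\<Delta>:] \<Longrightarrow>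
      \<Delta> \<noteq> 0 \<Longrightarrow> N \<ge> 1 \<Longrightarrow> \<bar>(\<Sum>d=1..N. density_term f d) - sqfree_density f\<bar>
        \<le> Ct * \<bar>real_of_int \<Delta>\<bar> powr \<eta> * real N powr (2 * \<eta> - 1)"
    using sqfree_density_tail[OF \<eta> k] by blast
  obtain K where K: "K > 0" "\<And>f. content f = 1 \<Longrightarrow> \<bar>sqfree_density f\<bar> \<le> K"
    using abs_sqfree_density_le by blast
  define Cg where "Cg = Ct * (2 * real k) powr (c * \<eta>)"
  have Cg: "Cg > 0" using Ct k by (simp add: Cg_def)
  define C where "C = 3 ^ (k + 1) * Cg + (1 + K) * real k * 3 ^ k"
  have "real N * (\<Sum>f\<in>primitive_polys k H. \<bar>truncated_density f N - sqfree_density f\<bar>)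
      \<le> C * real_of_int H ^ (k + 1) * real N powr \<epsilon>"
    if N: "N \<ge> 1" and H: "real N ^ 3 \<le> real_of_int H" and HA: "real_of_int H \<le> real N powr A" for N H
  proof -
    have N1: "real N \<ge> 1" using N by simp
    have "real N ^ 2 \<le> real N ^ 3" using N1 by (intro power_increasing) auto
    moreover have "1 \<le> real N ^ 3" using N1 by simp
    ultimately have N2H: "(real N)\<^sup>2 \<le> real_of_int H" and H1: "H \<ge> 1" using H by linarith+
    have H0: "H \<ge> 0" using H1 by simp
    let ?F = "primitive_polys k H"
    let ?t = "\<lambda>f. \<bar>truncated_density f N - sqfree_density f\<bar>"
    let ?G = "{f \<in> ?F. separable_poly f}" and ?B = "{f \<in> ?F. \<not> separable_poly f}"
    have finF: "finite ?F" using primitive_polys_finite_subset(1)[OF H0] .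
    have F: "f \<in> box_polys k H" "content f = 1" "degree f \<le> k" if "f \<in> ?F" for f
      using that by (auto simp: primitive_polys_eq[OF H0] box_polys_def)
    have good: "?t f \<le> Cg * real N powr (\<epsilon> - 1)" if f: "f \<in> ?G" for f
    proof -
      obtain \<Delta> u v where \<Delta>: "\<Delta> \<noteq> 0" "\<bar>\<Delta>\<bar> \<le> (2 * int k * H) ^ (2 ^ (2 * k))" "u * f + v * pderiv f = [:\<Delta>:]"
        using separable_poly_bezout[of f k H] F[of f] f k H1 by auto
      have "\<bar>real_of_int \<Delta>\<bar> \<le> real_of_int ((2 * int k * H) ^ (2 ^ (2 * k)))"
        using \<Delta>(2) by (metis of_int_abs of_int_le_iff)
      also have "\<dots> = (2 * real k * real_of_int H) ^ (2 ^ (2 * k))" by simp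
      also have "\<dots> = (2 * real k * real_of_int H) powr c"
        using k H1 by (subst powr_realpow[symmetric]) (auto simp: c_def)
      finally have "\<bar>real_of_int \<Delta>\<bar> powr \<eta> \<le> ((2 * real k * real_of_int H) powr c) powr \<eta>"
        using \<eta> by (intro powr_mono2) auto
      also have "\<dots> = (2 * real k) powr (c * \<eta>) * real_of_int H powr (c * \<eta>)"
        using H0 by (simp add: powr_powr powr_mult)
      also have "real_of_int H powr (c * \<eta>) \<le> (real N powr A) powr (c * \<eta>)"
        using HA H0 c0 \<eta> by (intro powr_mono2) auto
      also have "\<dots> = real N powr (A * (c * \<eta>))" by (simp add: powr_powr)
      finally have D: "\<bar>real_of_int \<Delta>\<bar> powr \<eta> \<le> (2 * real k) powr (c * \<eta>) * real N powr (A * (c * \<eta>))"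
        by (simp add: mult_left_mono)
      have "?t f \<le> Ct * \<bar>real_of_int \<Delta>\<bar> powr \<eta> * real N powr (2 * \<eta> - 1)"
        unfolding truncated_density_def using f F[of f] \<Delta> N by (intro Ct(2)) auto
      also have "\<dots> \<le> Ct * ((2 * real k) powr (c * \<eta>) * real N powr (A * (c * \<eta>))) * real N powr (2 * \<eta> - 1)"
        using Ct(1) D by (intro mult_right_mono mult_left_mono) auto
      also have "\<dots> = Cg * (real N powr (A * (c * \<eta>)) * real N powr (2 * \<eta> - 1))" by (simp add: Cg_def)
      also have "\<dots> = Cg * real N powr (A * (c * \<eta>) + (2 * \<eta> - 1))" by (simp only: powr_add)
      also have "\<dots> \<le> Cg * real N powr (\<epsilon> - 1)"
        using Cg N1 \<eta>\<epsilon> by (intro mult_left_mono powr_mono) auto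
      finally show ?thesis .
    qed
    have bad: "?t f \<le> real N * (1 + K)" if f: "f \<in> ?B" for f
    proof -
      have "?t f \<le> real N + K" using abs_truncated_density_le[of f N] K(2)[of f] F[of f] f by auto
      also have "\<dots> \<le> real N + real N * K" using K(1) N1 by simp
      finally show ?thesis by (simp add: algebra_simps)
    qed
    have cG: "real (card ?G) \<le> 3 ^ (k + 1) * real_of_int H ^ (k + 1)"
    proof -
      have "card ?G \<le> card (box_polys k H)"
        using primitive_polys_finite_subset(2)[OF H0, of k] by (intro card_mono finite_box_polys H0) auto
      hence "real (card ?G) \<le> real (card (box_polys k H))" by (rule of_nat_mono)
      also have "\<dots> = (2 * real_of_int H + 1) ^ (k + 1)" using H0 by (simp add: card_box_polys)
      also have "\<dots> \<le> 3 ^ (k + 1) * real_of_int H ^ (k + 1)" by (rule double_plus_one_power_le[OF H1])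
      finally show ?thesis .
    qed
    have cB: "real (card ?B) \<le> real k * (3 ^ k * real_of_int H ^ k)"
    proof -
      obtain j where j: "k = Suc j" using k by (cases k) auto
      have "card ?B \<le> j * nat (2 * H + 1) ^ Suc j"
        using card_nonseparable_le[OF H0, of j] unfolding j by (simp add: primitive_polys_eq[OF H0] conj_assoc)
      hence "real (card ?B) \<le> real (j * nat (2 * H + 1) ^ Suc j)" by (rule of_nat_mono)
      also have "\<dots> = real j * (2 * real_of_int H + 1) ^ k" using H0 by (simp add: j)
      also have "\<dots> \<le> real k * (3 ^ k * real_of_int H ^ k)"
        using H1 by (intro mult_mono double_plus_one_power_le) (auto simp: j)
      finally show ?thesis .
    qed
    have "(\<Sum>f\<in>?F. ?t f) = (\<Sum>f\<in>?G. ?t f) + (\<Sum>f\<in>?B. ?t f)"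
    proof -
      have "(\<Sum>f\<in>?F. ?t f) = (\<Sum>f\<in>?G \<union> ?B. ?t f)" by (rule sum.cong) auto
      also have "\<dots> = (\<Sum>f\<in>?G. ?t f) + (\<Sum>f\<in>?B. ?t f)" by (rule sum.union_disjoint) (use finF in auto)
      finally show ?thesis .
    qed
    also have "\<dots> \<le> (\<Sum>f\<in>?G. Cg * real N powr (\<epsilon> - 1)) + (\<Sum>f\<in>?B. real N * (1 + K))"
      using good bad by (intro add_mono sum_mono) auto
    also have "\<dots> = real (card ?G) * (Cg * real N powr (\<epsilon> - 1)) + real (card ?B) * (real N * (1 + K))" by simp
    also have "\<dots> \<le> 3 ^ (k + 1) * real_of_int H ^ (k + 1) * (Cg * real N powr (\<epsilon> - 1))
        + real k * (3 ^ k * real_of_int H ^ k) * (real N * (1 + K))"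
      using cG cB Cg K(1) by (intro add_mono mult_right_mono) auto
    finally have "real N * (\<Sum>f\<in>?F. ?t f) \<le> real N * (3 ^ (k + 1) * real_of_int H ^ (k + 1) * (Cg * real N powr (\<epsilon> - 1))
        + real k * (3 ^ k * real_of_int H ^ k) * (real N * (1 + K)))" by (rule mult_left_mono) simp
    also have "\<dots> = 3 ^ (k + 1) * Cg * real_of_int H ^ (k + 1) * (real N powr 1 * real N powr (\<epsilon> - 1))
        + (1 + K) * real k * 3 ^ k * ((real N)\<^sup>2 * real_of_int H ^ k)"
      using N1 by (simp add: algebra_simps power2_eq_square)
    also have "real N powr 1 * real N powr (\<epsilon> - 1) = real N powr \<epsilon>" by (subst powr_add[symmetric]) simp
    also have "3 ^ (k + 1) * Cg * real_of_int H ^ (k + 1) * real N powr \<epsilon>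
          + (1 + K) * real k * 3 ^ k * ((real N)\<^sup>2 * real_of_int H ^ k)
        \<le> 3 ^ (k + 1) * Cg * real_of_int H ^ (k + 1) * real N powr \<epsilon>
          + (1 + K) * real k * 3 ^ k * (real_of_int H ^ (k + 1) * real N powr \<epsilon>)"
    proof (intro add_left_mono mult_left_mono)
      have "(real N)\<^sup>2 * real_of_int H ^ k \<le> real_of_int H * real_of_int H ^ k"
        using N2H H0 by (intro mult_right_mono) auto
      also have "\<dots> = real_of_int H ^ (k + 1) * 1" by simp
      also have "\<dots> \<le> real_of_int H ^ (k + 1) * real N powr \<epsilon>"
        using N1 \<epsilon> H0 by (intro mult_left_mono ge_one_powr_ge_zero) auto
      finally show "(real N)\<^sup>2 * real_of_int H ^ k \<le> real_of_int H ^ (k + 1) * real N powr \<epsilon>" .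
    qed (use K in simp)
    also have "\<dots> = C * real_of_int H ^ (k + 1) * real N powr \<epsilon>" by (simp add: C_def algebra_simps)
    finally show ?thesis .
  qed
  moreover have "C > 0" using Cg K(1) by (simp add: C_def add_pos_nonneg)
  ultimately show ?thesis by blast
qed

theorem theorem1:
  fixes k :: nat and \<epsilon> A :: real
  assumes "k \<ge> 2" and "\<epsilon> > 0" and "A \<ge> real (k + 1)"
  shows "\<exists>C :: real. C > 0 \<and>
    (\<forall>(N :: nat) (H :: int).
       N \<ge> 1 \<and> real N ^ (k + 1) \<le> real_of_int H \<and> real_of_int H \<le> real N powr A \<longrightarrow>
       \<bar>1 / real (card (primitive_polys k H)) *
          (\<Sum>f\<in>primitive_polys k H. real (squarefree_count f N) - sqfree_density f * real N)\<bar>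
       \<le> C * real N powr \<epsilon>)"
proof -
  have k1: "k \<ge> 1" and A: "A > 0" using assms by linarith+
  obtain C2 where C2: "C2 > 0" "\<And>N H. N \<ge> 1 \<Longrightarrow> real N ^ 3 \<le> real_of_int H \<Longrightarrow>
      \<bar>\<Sum>f\<in>primitive_polys k H. truncated_count f N - real N * truncated_density f N\<bar>
      \<le> C2 * 3 ^ k * real_of_int H ^ (k + 1)"
    using sum_truncated_count_density k1 by blast
  obtain C3 where C3: "C3 > 0" "\<And>N H. N \<ge> 1 \<Longrightarrow> real N ^ 3 \<le> real_of_int H \<Longrightarrow>
      real_of_int H \<le> real N powr A \<Longrightarrow>
      real N * (\<Sum>f\<in>primitive_polys k H. \<bar>truncated_density f N - sqfree_density f\<bar>)
      \<le> C3 * real_of_int H ^ (k + 1) * real N powr \<epsilon>"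
    using sum_density_tails[OF k1 assms(2) A] by blast
  define C1 where "C1 = (3 ^ k * (2 * real k + 3) :: real)"
  \<comment> \<open>The factor 4 comes from the lower bound \<open>H ^ (k + 1) / 4\<close> for the
    number of primitive polynomials.\<close>
  define C where "C = 4 * (C1 + C2 * 3 ^ k + C3)"
  have C1: "C1 > 0" by (simp add: C1_def add_nonneg_pos)
  have "\<bar>1 / real (card (primitive_polys k H)) *
          (\<Sum>f\<in>primitive_polys k H. real (squarefree_count f N) - sqfree_density f * real N)\<bar>
       \<le> C * real N powr \<epsilon>"
    if N: "N \<ge> 1" and HB: "real N ^ (k + 1) \<le> real_of_int H" and HA: "real_of_int H \<le> real N powr A" for N H
  proof -
    have N1: "real N \<ge> 1" using N by simp
    \<comment> \<open>Since \<open>k\<close> is at least 2, the cubic lower bound for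
      \<open>H\<close> used by all estimates is available.\<close>
    have "real N ^ 3 \<le> real N ^ (k + 1)" using N1 assms(1) by (intro power_increasing) auto
    hence H: "real N ^ 3 \<le> real_of_int H" using HB by linarith
    have "1 \<le> real N ^ 3" using N1 by simp
    hence H1: "H \<ge> 1" using H by linarith
    let ?F = "primitive_polys k H" and ?h = "real_of_int H ^ (k + 1)" and ?n = "real N powr \<epsilon>"
    have n1: "?n \<ge> 1" using N1 assms(2) by (intro ge_one_powr_ge_zero) auto
    have h0: "?h > 0" using H1 by simp
    define S1 where "S1 = (\<Sum>f\<in>?F. real (squarefree_count f N) - truncated_count f N)"
    define S2 where "S2 = (\<Sum>f\<in>?F. truncated_count f N - real N * truncated_density f N)"
    define S3 where "S3 = (\<Sum>f\<in>?F. truncated_density f N - sqfree_density f)"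
    have split: "(\<Sum>f\<in>?F. real (squarefree_count f N) - sqfree_density f * real N) = S1 + S2 + real N * S3"
      unfolding S1_def S2_def S3_def sum_distrib_left sum.distrib[symmetric]
      by (rule sum.cong) (simp_all add: algebra_simps)
    have b1: "\<bar>S1\<bar> \<le> C1 * ?h"
      unfolding S1_def C1_def by (rule sum_squarefree_count_truncation[OF N H])
    have b2: "\<bar>S2\<bar> \<le> C2 * 3 ^ k * ?h" unfolding S2_def by (rule C2(2)[OF N H])
    have "\<bar>real N * S3\<bar> \<le> real N * (\<Sum>f\<in>?F. \<bar>truncated_density f N - sqfree_density f\<bar>)"
      unfolding abs_mult S3_def by (simp add: mult_left_mono sum_abs)
    hence b3: "\<bar>real N * S3\<bar> \<le> C3 * ?h * ?n" using C3(2)[OF N H HA] by linarith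
    have "\<bar>S1 + S2 + real N * S3\<bar> \<le> (C1 + C2 * 3 ^ k) * ?h * 1 + C3 * ?h * ?n"
      using b1 b2 b3 by (simp add: distrib_right)
    \<comment> \<open>The two truncation errors carry no power of \<open>N\<close>; the factor
      \<open>N powr \<epsilon>\<close> stems from the density tails alone.\<close>
    also have "\<dots> \<le> (C1 + C2 * 3 ^ k) * ?h * ?n + C3 * ?h * ?n"
      using n1 h0 C1 C2(1) by (intro add_right_mono mult_left_mono) auto
    also have "\<dots> = C * ?n * (?h / 4)" by (simp add: C_def algebra_simps)
    also have "\<dots> \<le> C * ?n * real (card ?F)"
      using card_primitive_polys_ge[OF H1 assms(1)] C1 C2(1) C3(1) by (intro mult_left_mono) (auto simp: C_def)
    finally have bound: "\<bar>S1 + S2 + real N * S3\<bar> \<le> C * ?n * real (card ?F)" .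
    have "real (card ?F) > 0" using card_primitive_polys_ge[OF H1 assms(1)] h0 by linarith
    thus ?thesis unfolding split using bound by (simp add: abs_mult field_simps)
  qed
  moreover have "C > 0" using C1 C2(1) C3(1) by (simp add: C_def add_pos_pos)
  ultimately show ?thesis by blast
qed

end
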